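(* Let $(g,h)$ be an admissible constraint pair. For any given $s\in D[0,\infty)$, there exists a unique pair $(x,k)\in D[0,\infty)\times BV[0,\infty)$ solving the Skorokhod problem $\mathbb{SP}_g^h(s)$. Moreover, writing, for $t\ge 0$, $\phi_t=g^{-1}(t,0)-s_t$ and $\psi_t=h^{-1}(t,0)-s_t$, the second component $k$ of the solution has the representation $$k_t=\min\left(\left[-\phi_0^-\right]\vee \sup_{r\in[0,t]}\psi_r,\ \inf_{u\in[0,t]}\left[\phi_u\vee \sup_{r\in[u,t]}\psi_r\right]\right),\qquad t\ge 0.$$
   Context: $D[0,\infty)$ is the set of real-valued càdlàg functions on $[0,\infty)$, and $BV[0,\infty)\subset D[0,\infty)$ the subset of functions of bounded variation. $a^-=\max(-a,0)$, $a\vee b=\max(a,b)$. Admissible constraint pair: functions $g,h:[0,\infty)\times\mathbb{R}\to\mathbb{R}$ such that (i) for each fixed $x\in\mathbb{R}$, $g(\cdot,x),h(\cdot,x)\in D[0,\infty)$; (ii) for any fixed $t\ge0$, $g(t,\cdot)$ and $h(t,\cdot)$ are strictly increasing, and $g(t,x)<h(t,x)$ for any $(t,x)\in[0,\infty)\times\mathbb{R}$; (iii) for any $t\geq 0$, the inverses $g^{-1}(t,0)$ and $h^{-1}(t,0)$ (the points at which $g(t,\cdot)$, respectively $h(t,\cdot)$, vanish) exist, $g^{-1}(\cdot,0),h^{-1}(\cdot,0)\in D[0,\infty)$, and $\inf_{t\geq 0}(g^{-1}(t,0)-h^{-1}(t,0))>0$. Skorokhod problem: given $s\in D[0,\infty)$,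 a pair $(x,k)\in D[0,\infty)\times BV[0,\infty)$ solves the Skorokhod problem for $s$ with nonlinear constraints $g,h$, written $(x,k)=\mathbb{SP}_g^h(s)$, if for all $t\ge 0$: (i) $x_t=s_t+k_t$; (ii) $g(t,x_t)\le 0\le h(t,x_t)$; (iii) $k_{0-}=0$ and $k$ has a decomposition $k=k^h-k^g$ with $k^h,k^g$ nondecreasing functions satisfying $$\int_0^\infty I_{\{g(u,x_u)<0\}}\,dk^g_u=0,\qquad \int_0^\infty I_{\{h(u,x_u)>0\}}\,dk^h_u=0.$$ Conventions: $k_{0-}=k^h_{0-}=k^g_{0-}=0$, and the integrals over $[0,\infty)$ include the possible atoms at time $0$ of sizes $k^g_0$ and $k^h_0$. *)

theory Defs
  imports "HOL-Analysis.Analysis"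
begin

text \<open>
  A function on $[0,\infty)$ is represented by a total function on the reals whose values at
  negative arguments are irrelevant; equality of such functions is equality on \<open>{0..}\<close>.
\<close>

definition Dspace :: "(real \<Rightarrow> real) set" where
  "Dspace = {f. (\<forall>t\<ge>0. continuous (at_right t) f) \<and> (\<forall>t>0. \<exists>l. (f \<longlongrightarrow> l) (at_left t))}"

definition bounded_variation_between :: "(real \<Rightarrow> real) \<Rightarrow> real \<Rightarrow> real \<Rightarrow> bool" where
  "bounded_variation_between f a b \<longleftrightarrow>
     (\<exists>B. \<forall>(n::nat) p. mono_on {..n} p \<and> p ` {..n} \<subseteq> {a..b} \<longrightarrow>
        (\<Sum>i<n. \<bar>f (p (Suc i)) - f (p i)\<bar>) \<le> B)"

text \<open>
  Bounded variation on $[0,\infty)$ is meant in the sense of the Skorokhod problem literature: finite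
  variation on every compact interval. (The total variation over the whole half-line
  of the constraining term is infinite in general, e.g. when \<open>s\<close> oscillates forever.)
\<close>

definition BVspace :: "(real \<Rightarrow> real) set" where
  "BVspace = {f \<in> Dspace. \<forall>T\<ge>0. bounded_variation_between f 0 T}"

text \<open>
  The inverse \<open>g\<^sup>-\<^sup>1(t,0)\<close> is \<open>inv (g t) 0\<close>. It is the unique zero of \<open>g t\<close> once
  \<open>0 \<in> range (g t)\<close> and \<open>g t\<close> is strictly increasing. The infimum is a genuine one, since
  the set is bounded below by 0 because of \<open>g t x < h t x\<close> and monotonicity.
\<close>

definition admissible_pair :: "(real \<Rightarrow> real \<Rightarrow> real) \<Rightarrow> (real \<Rightarrow> real \<Rightarrow> real) \<Rightarrow> bool" where
  "admissible_pair g h \<longleftrightarrow>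
     (\<forall>x. (\<lambda>t. g t x) \<in> Dspace \<and> (\<lambda>t. h t x) \<in> Dspace) \<and>
     (\<forall>t\<ge>0. strict_mono (g t) \<and> strict_mono (h t) \<and> (\<forall>x. g t x < h t x)) \<and>
     (\<forall>t\<ge>0. 0 \<in> range (g t) \<and> 0 \<in> range (h t)) \<and>
     (\<lambda>t. inv (g t) 0) \<in> Dspace \<and> (\<lambda>t. inv (h t) 0) \<in> Dspace \<and>
     (INF t\<in>{0..}. inv (g t) 0 - inv (h t) 0) > 0"

text \<open>
  The convention \<open>k\<^sub>0\<^sub>- = 0\<close>: extend by 0 to the negative half-line. The measure induced by
  the extension of a nondecreasing right-continuous \<open>k\<close> then has an atom of mass \<open>k 0\<close> at 0.
\<close>

definition zero_ext :: "(real \<Rightarrow> real) \<Rightarrow> real \<Rightarrow> real" where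
  "zero_ext k t = (if t < 0 then 0 else k t)"

text \<open>
  Monotonicity of the extension amounts to \<open>k\<close> being nondecreasing on \<open>{0..}\<close> with
  \<open>0 \<le> k 0\<close>. Right-continuity makes \<open>k\<close> the distribution function of \<open>dk\<close>.
\<close>

definition increasing_process :: "(real \<Rightarrow> real) \<Rightarrow> bool" where
  "increasing_process k \<longleftrightarrow> k \<in> Dspace \<and> mono (zero_ext k)"

abbreviation stieltjes :: "(real \<Rightarrow> real) \<Rightarrow> real measure" where
  "stieltjes k \<equiv> interval_measure (zero_ext k)"

text \<open>
  The indicator functions below are Borel measurable on \<open>{0..}\<close> for an admissible pair, as
  \<open>g u (x u) < 0\<close> iff \<open>x u < inv (g u) 0\<close>, and similarly for \<open>h\<close>.
\<close>

definition solves_SP ::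
  "(real \<Rightarrow> real \<Rightarrow> real) \<Rightarrow> (real \<Rightarrow> real \<Rightarrow> real) \<Rightarrow> (real \<Rightarrow> real) \<Rightarrow>
   (real \<Rightarrow> real) \<Rightarrow> (real \<Rightarrow> real) \<Rightarrow> bool" where
  "solves_SP g h s x k \<longleftrightarrow>
     x \<in> Dspace \<and> k \<in> BVspace \<and>
     (\<forall>t\<ge>0. x t = s t + k t) \<and>
     (\<forall>t\<ge>0. g t (x t) \<le> 0 \<and> 0 \<le> h t (x t)) \<and>
     (\<exists>kh kg. increasing_process kh \<and> increasing_process kg \<and>
        (\<forall>t\<ge>0. k t = kh t - kg t) \<and>
        (\<integral>\<^sup>+u\<in>{0..}. indicator {u. g u (x u) < 0} u \<partial>stieltjes kg) = 0 \<and>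
        (\<integral>\<^sup>+u\<in>{0..}. indicator {u. h u (x u) > 0} u \<partial>stieltjes kh) = 0)"

definition neg_part :: "real \<Rightarrow> real" where
  "neg_part a = max (- a) 0"

end

theory Submission
  imports Defs
begin

text \<open>
  Put \<open>\<phi> = inv (g t) 0 - s\<close> and \<open>\<psi> = inv (h t) 0 - s\<close>. As \<open>g t\<close> and \<open>h t\<close> are strictly
  increasing, the constraints on \<open>x = s + k\<close> say that \<open>\<psi> \<le> k \<le> \<phi>\<close>, where \<open>k\<close> may be pushed up
  only at times with \<open>k = \<psi>\<close> and down only at times with \<open>k = \<phi>\<close>. Admissibility keeps the two
  barriers a positive distance apart.

  Existence is proved for the explicit formula \<open>double_reflection\<close>. It has a flow property
  (\<open>double_reflection_flow\<close>): it can be restarted at any time from the value reached there.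
  Near every time, on either side, a constant level separates the barriers, and on such an interval the flow
  property reduces \<open>k\<close> to a one-sided running maximum or minimum, followed by a projection at
  a jump time (\<open>double_reflection_split_separated\<close>). This exhibits the upward and the downward pushes
  explicitly. Bisection (\<open>double_reflection_split\<close>) and summation over the intervals \<open>[n,n+1]\<close>
  (\<open>glue_reflecting_splits\<close>) give pushes on \<open>[0,\<infinity>)\<close>; being monotone, they also show that \<open>k\<close> is
  cadlag and of bounded variation on compact intervals.

  The complementarity conditions are integrals against Stieltjes measures. They are obtained from the pointwise
  notion \<open>flat_at\<close>, which is stable under sums and easy to verify for running suprema; a covering
  argument (\<open>half_open_cover\<close>) shows that the flat points form a null set.

  Uniqueness is a comparison of two solutions after the last time at which they were in the opposite order
  (\<open>complementary_decomposition_le\<close>).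
\<close>

section \<open>Flat points of a function\<close>

lemma continuous_at_right_if_eventually_eq:
  assumes "\<forall>\<^sub>F v in at_right u. F v = G v" "F u = (G u :: real)" "continuous (at_right (u::real)) G"
  shows "continuous (at_right u) F"
  using assms unfolding continuous_within by (simp add: tendsto_cong)

text \<open>
  A local condition such that the measure \<open>dF\<close> does not charge the set of points that satisfy it:
  left-continuity excludes an atom at \<open>u\<close>, constancy on the right excludes growth just after it.
  Growth just before \<open>u\<close> has to be permitted: when the lower barrier jumps downwards at \<open>u\<close>,
  the constraint is strict at \<open>u\<close> although there may have been pushes right up to that time.
  A half-open interval at each point is enough for the covering argument.
\<close>

definition flat_at :: "(real \<Rightarrow> real) \<Rightarrow> real \<Rightarrow> bool" where
  "flat_at F u \<longleftrightarrow> isCont F u \<and> (\<forall>\<^sub>F v in at_right u. F v = F u)"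

lemma flat_at_add:
  assumes "flat_at F u" "flat_at G u"
  shows "flat_at (\<lambda>t. F t + G t) u"
  using assms unfolding flat_at_def
  by (auto intro: continuous_intros elim: eventually_elim2)

lemma flat_at_diff_const: "flat_at F u \<Longrightarrow> flat_at (\<lambda>t. F t - c) u"
  unfolding flat_at_def by (auto intro: continuous_intros)

lemma flat_at_const: "flat_at (\<lambda>_. c) u"
  by (simp add: flat_at_def)

lemma flat_at_cong:
  assumes "flat_at F u" and "\<forall>\<^sub>F v in nhds u. G v = F v"
  shows "flat_at G u"
proof -
  have "G u = F u" using eventually_nhds_x_imp_x[OF assms(2)] .
  moreover have "isCont G u" using assms isCont_cong flat_at_def by blast
  moreover have "\<forall>\<^sub>F v in at_right u. G v = F v"
    using assms(2) by (auto simp: eventually_at_filter elim: eventually_mono)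
  ultimately show ?thesis using assms(1) unfolding flat_at_def
    by (auto elim: eventually_elim2)
qed

lemmas flat_at_if_locally_const = flat_at_cong[where F="\<lambda>_. c" for c, OF flat_at_const]

section \<open>Running suprema\<close>

definition running_sup :: "real \<Rightarrow> (real \<Rightarrow> real) \<Rightarrow> real \<Rightarrow> real" where
  "running_sup c f t = Sup (insert c (f ` {..t}))"

lemma running_sup_le_iff:
  assumes "bdd_above (range f)"
  shows "running_sup c f t \<le> y \<longleftrightarrow> c \<le> y \<and> (\<forall>r\<le>t. f r \<le> y)"
proof -
  have "bdd_above (insert c (f ` {..t}))"
    using assms by (meson bdd_above_insert bdd_above_mono image_mono subset_UNIV)
  then show ?thesis unfolding running_sup_def by (subst cSup_le_iff) auto
qed

lemma running_sup_ge:
  assumes "bdd_above (range f)"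
  shows "c \<le> running_sup c f t" and "r \<le> t \<Longrightarrow> f r \<le> running_sup c f t"
proof -
  have "bdd_above (insert c (f ` {..t}))"
    using assms by (meson bdd_above_insert bdd_above_mono image_mono subset_UNIV)
  then show "c \<le> running_sup c f t" and "r \<le> t \<Longrightarrow> f r \<le> running_sup c f t"
    unfolding running_sup_def by (auto intro: cSup_upper)
qed

lemma mono_running_sup: "bdd_above (range f) \<Longrightarrow> mono (running_sup c f)"
  by (intro monoI) (auto simp: running_sup_le_iff running_sup_ge)

lemma running_sup_eq:
  assumes "bdd_above (range f)" "s \<le> t" "\<And>r. s < r \<Longrightarrow> r \<le> t \<Longrightarrow> f r \<le> running_sup c f s"
  shows "running_sup c f t = running_sup c f s"
proof (rule antisym)
  show "running_sup c f s \<le> running_sup c f t"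
    using mono_running_sup[OF assms(1)] assms(2) by (rule monoD)
  have "f r \<le> running_sup c f s" if "r \<le> t" for r
    using that assms(3)[of r] running_sup_ge(2)[OF assms(1), of r s c] by fastforce
  then show "running_sup c f t \<le> running_sup c f s"
    using running_sup_ge[OF assms(1)] by (subst running_sup_le_iff[OF assms(1)]) auto
qed

lemma right_continuous_running_sup:
  assumes bdd: "bdd_above (range f)" and rc: "continuous (at_right u) f"
  shows "continuous (at_right u) (running_sup c f)"
  unfolding continuous_within
proof (rule order_tendstoI)
  fix y assume "y < running_sup c f u"
  then show "\<forall>\<^sub>F v in at_right u. y < running_sup c f v"
    using monoD[OF mono_running_sup[OF bdd, of c]]
    by (auto simp: eventually_at_filter intro!: always_eventually
        less_le_trans[of y "running_sup c f u" "running_sup c f _"])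
next
  fix y assume y: "running_sup c f u < y"
  then obtain z where z: "running_sup c f u < z" "z < y" using dense by blast
  have "f u < z" using z(1) running_sup_ge(2)[OF bdd, of u u c] by simp
  then have "\<forall>\<^sub>F v in at_right u. f v < z"
    using rc unfolding continuous_within by (intro order_tendstoD(2))
  then obtain b where b: "b > u" "\<And>v. u < v \<Longrightarrow> v < b \<Longrightarrow> f v < z"
    by (auto simp: eventually_at_right_field)
  have "running_sup c f v \<le> z" if "u < v" "v < b" for v
  proof (subst running_sup_le_iff[OF bdd], intro conjI allI impI)
    show "c \<le> z" using z running_sup_ge(1)[OF bdd, of c u] by simp
    fix r assume "r \<le> v"
    then show "f r \<le> z"
      using b(2)[of r] that z running_sup_ge(2)[OF bdd, of r u c] by force
  qed
  then show "\<forall>\<^sub>F v in at_right u. running_sup c f v < y"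
    using b(1) z(2) by (force simp: eventually_at_right_field)
qed

text \<open>
  A running supremum that lies strictly above the current value of \<open>f\<close> is not being renewed:
  right-continuity keeps \<open>f\<close> below it for a while, and the supremum was already approached at
  times strictly before \<open>u\<close> (or by the constant \<open>c\<close>), which gives continuity from the left.
\<close>

lemma flat_at_running_sup:
  assumes bdd: "bdd_above (range f)" and rc: "continuous (at_right u) f"
    and less: "f u < running_sup c f u"
  shows "flat_at (running_sup c f) u"
proof -
  let ?R = "running_sup c f"
  have "\<forall>\<^sub>F v in at_right u. f v < ?R u"
    using rc less unfolding continuous_within by (intro order_tendstoD(2))
  then obtain b where b: "b > u" "\<And>v. u < v \<Longrightarrow> v < b \<Longrightarrow> f v < ?R u"
    by (auto simp: eventually_at_right_field)
  have "?R v = ?R u" if "u < v" "v < b" for v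
    using that b by (intro running_sup_eq[OF bdd]) force+
  then have const: "\<forall>\<^sub>F v in at_right u. ?R v = ?R u"
    using b(1) by (force simp: eventually_at_right_field)
  have "(?R \<longlongrightarrow> ?R u) (at_left u)"
  proof (rule order_tendstoI)
    fix y assume "y < ?R u"
    define z where "z = max y (f u)"
    have "z < ?R u" using \<open>y < ?R u\<close> less by (simp add: z_def)
    then have "\<not> ?R u \<le> z" by simp
    then consider "z < c" | r where "r \<le> u" "z < f r"
      unfolding running_sup_le_iff[OF bdd] by force
    then have "\<exists>a<u. \<forall>v. a < v \<longrightarrow> y < ?R v"
    proof cases
      case 1
      then have "\<forall>v. y < ?R v"
        using running_sup_ge(1)[OF bdd, of c] unfolding z_def by (meson max_less_iff_conj less_le_trans)
      then show ?thesis using lt_ex by blast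
    next
      case 2
      then have "r < u" "y < f r" unfolding z_def by (auto simp: less_le)
      then show ?thesis
        using running_sup_ge(2)[OF bdd, of r _ c] by (meson less_le_trans less_imp_le)
    qed
    then show "\<forall>\<^sub>F v in at_left u. y < ?R v"
      by (auto simp: eventually_at_left_field)
  next
    fix y assume "?R u < y"
    then show "\<forall>\<^sub>F v in at_left u. ?R v < y"
      using monoD[OF mono_running_sup[OF bdd, of c]]
      by (auto simp: eventually_at_filter intro!: always_eventually le_less_trans[of "?R _" "?R u" y])
  qed
  moreover have "(?R \<longlongrightarrow> ?R u) (at_right u)"
    using right_continuous_running_sup[OF bdd rc] unfolding continuous_within .
  ultimately have "isCont ?R u"
    by (simp add: isCont_def filterlim_at_split)
  with const show ?thesis unfolding flat_at_def by blast
qed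

section \<open>Splitting increments into pushes at the two barriers\<close>

text \<open>
  The increments of \<open>k\<close> over \<open>[a,b]\<close> as a difference of an upward push \<open>P\<close>, acting only at the
  lower barrier \<open>\<psi>\<close>, and a downward push \<open>N\<close>, acting only at the upper barrier \<open>\<phi>\<close>.
  Both are functions on the whole line, zero up to \<open>a\<close> and constant from \<open>b\<close> on, so that splits
  over adjacent intervals are joined by adding them. Constancy beyond \<open>b\<close> is phrased with
  existential constants since the equation \<open>P t = P b\<close> would rewrite its own right-hand side.
\<close>

definition reflecting_split ::
  "(real \<Rightarrow> real) \<Rightarrow> (real \<Rightarrow> real) \<Rightarrow> (real \<Rightarrow> real) \<Rightarrow> real \<Rightarrow> real \<Rightarrow>
   (real \<Rightarrow> real) \<Rightarrow> (real \<Rightarrow> real) \<Rightarrow> bool" where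
  "reflecting_split \<psi> \<phi> k a b P N \<longleftrightarrow>
     mono P \<and> mono N \<and>
     (\<forall>u. continuous (at_right u) P) \<and> (\<forall>u. continuous (at_right u) N) \<and>
     (\<forall>t\<le>a. P t = 0 \<and> N t = 0) \<and> (\<exists>p n. \<forall>t\<ge>b. P t = p \<and> N t = n) \<and>
     (\<forall>t\<in>{a..b}. k t - k a = P t - N t) \<and>
     (\<forall>u\<in>{a..b}. \<psi> u < k u \<longrightarrow> flat_at P u) \<and>
     (\<forall>u\<in>{a..b}. k u < \<phi> u \<longrightarrow> flat_at N u)"

text \<open>
  Outside \<open>[a,b]\<close> both pushes are locally constant, so the restriction to \<open>[a,b]\<close> in the
  definition can be dropped.
\<close>

lemma reflecting_split_flat:
  assumes "reflecting_split \<psi> \<phi> k a b P N"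
  shows "\<psi> u < k u \<Longrightarrow> flat_at P u" and "k u < \<phi> u \<Longrightarrow> flat_at N u"
proof -
  have out: "flat_at P u \<and> flat_at N u" if "u \<notin> {a..b}"
  proof -
    consider "u < a" | "b < u" using \<open>u \<notin> {a..b}\<close> by force
    then show ?thesis
    proof cases
      case 1
      have "\<forall>\<^sub>F v in nhds u. P v = 0 \<and> N v = 0"
        by (rule eventually_mono[OF eventually_nhds_in_open[of "{..<a}"]])
           (use 1 assms in \<open>auto simp: reflecting_split_def\<close>)
      then show ?thesis
        by (auto simp: eventually_conj_iff intro: flat_at_if_locally_const)
    next
      case 2
      obtain p n where "\<And>t. t \<ge> b \<Longrightarrow> P t = p \<and> N t = n"
        using assms unfolding reflecting_split_def by blast
      then have "\<forall>\<^sub>F v in nhds u. P v = p \<and> N v = n"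
        using eventually_nhds_in_open[of "{b<..}" u] 2 by (auto elim!: eventually_mono)
      then show ?thesis
        by (auto simp: eventually_conj_iff intro: flat_at_if_locally_const)
    qed
  qed
  show "\<psi> u < k u \<Longrightarrow> flat_at P u" "k u < \<phi> u \<Longrightarrow> flat_at N u"
    using out assms unfolding reflecting_split_def by blast+
qed

lemma reflecting_split_refl: "reflecting_split \<psi> \<phi> k a a (\<lambda>_. 0) (\<lambda>_. 0)"
  by (auto simp: reflecting_split_def flat_at_def intro: monoI)

lemma reflecting_split_join:
  assumes 1: "reflecting_split \<psi> \<phi> k a b P N" and 2: "reflecting_split \<psi> \<phi> k b c P' N'"
    and "a \<le> b" "b \<le> c"
  shows "reflecting_split \<psi> \<phi> k a c (\<lambda>t. P t + P' t) (\<lambda>t. N t + N' t)"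
proof -
  obtain p n where pn: "\<And>t. t \<ge> b \<Longrightarrow> P t = p \<and> N t = n"
    using 1 unfolding reflecting_split_def by blast
  obtain p' n' where pn': "\<And>t. t \<ge> c \<Longrightarrow> P' t = p' \<and> N' t = n'"
    using 2 unfolding reflecting_split_def by blast
  have sum: "k t - k a = P t + P' t - (N t + N' t)" if "t \<in> {a..c}" for t
  proof (cases "t \<le> b")
    case True
    then have "P' t = 0" "N' t = 0" using 2 by (auto simp: reflecting_split_def)
    moreover have "k t - k a = P t - N t" using 1 True that by (auto simp: reflecting_split_def)
    ultimately show ?thesis by simp
  next
    case False
    have "k b - k a = P b - N b" using 1 assms(3) by (auto simp: reflecting_split_def)
    moreover have "k t - k b = P' t - N' t" using 2 False that by (auto simp: reflecting_split_def)
    ultimately show ?thesis using pn[of t] pn[of b] False by simp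
  qed
  show ?thesis
    unfolding reflecting_split_def
  proof (intro conjI ballI allI impI)
    show "mono (\<lambda>t. P t + P' t)" "mono (\<lambda>t. N t + N' t)"
      using 1 2 by (auto simp: reflecting_split_def mono_def add_mono)
    show "continuous (at_right u) (\<lambda>t. P t + P' t)" "continuous (at_right u) (\<lambda>t. N t + N' t)" for u
      using 1 2 by (auto simp: reflecting_split_def intro!: continuous_add)
    show "P t + P' t = 0" "N t + N' t = 0" if "t \<le> a" for t
      using 1 2 that \<open>a \<le> b\<close> by (auto simp: reflecting_split_def)
    show "\<exists>p n. \<forall>t\<ge>c. P t + P' t = p \<and> N t + N' t = n"
      using pn pn' \<open>b \<le> c\<close> by (intro exI[of _ "p + p'"] exI[of _ "n + n'"]) auto
  qed (use sum flat_at_add reflecting_split_flat[OF 1] reflecting_split_flat[OF 2] in blast)+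
qed

text \<open>
  Reflection exchanges the barriers; one of two mirror-image cases is enough below.
\<close>

lemma reflecting_split_uminus:
  assumes "reflecting_split (\<lambda>t. - \<phi> t) (\<lambda>t. - \<psi> t) (\<lambda>t. - k t) a b P N"
  shows "reflecting_split \<psi> \<phi> k a b N P"
  using assms unfolding reflecting_split_def by force

text \<open>
  The basic piece. On \<open>[a,b)\<close> a level \<open>m\<close> separates the barriers and \<open>k\<close> stays below it, so only the
  lower barrier acts, and the upward push is the running supremum of \<open>\<psi>\<close> started at \<open>k a\<close>.
  At \<open>b\<close>, where both barriers may jump arbitrarily, \<open>k\<close> is the projection of its left limit \<open>L\<close>
  to the interval between the new barriers. If the jump is upwards, it continues the running supremum;
  if it is downwards, it is the only contribution to the push from above.
\<close>

lemma reflecting_split_below_level: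
  assumes "a < b"
    and rc: "\<And>u. a \<le> u \<Longrightarrow> u < b \<Longrightarrow> continuous (at_right u) \<psi>"
    and below: "\<And>u. a \<le> u \<Longrightarrow> u < b \<Longrightarrow> \<psi> u \<le> m"
    and above: "\<And>u. a \<le> u \<Longrightarrow> u < b \<Longrightarrow> m \<le> \<phi> u"
    and "k a \<le> m" "\<psi> a \<le> k a" "\<psi> b \<le> \<phi> b"
    and k: "\<And>t. a \<le> t \<Longrightarrow> t < b \<Longrightarrow> k t = Sup (insert (k a) (\<psi> ` {a..t}))"
    and kb: "k b = max (\<psi> b) (min (\<phi> b) (Sup (insert (k a) (\<psi> ` {a..<b}))))"
  shows "\<exists>P N. reflecting_split \<psi> \<phi> k a b P N"
proof -
  \<comment> \<open>\<open>\<psi>\<close> stopped outside \<open>[a,b]\<close>, so that its running supremum is constant there\<close>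
  define f where "f = (\<lambda>t. \<psi> (max a (min b t)))"
  define L where "L = Sup (insert (k a) (\<psi> ` {a..<b}))"
  define R where "R = running_sup (k a) f"
  \<comment> \<open>the size of a downward jump at \<open>b\<close>, from the left limit \<open>L\<close> to the upper barrier\<close>
  define J where "J = max (L - \<phi> b) 0"
  define N where "N = (\<lambda>t. if t < b then 0 else J)"
  have bdd: "bdd_above (range f)"
  proof (rule bdd_aboveI2)
    fix t show "f t \<le> max m (\<psi> b)"
      using below[of "max a (min b t)"] \<open>a < b\<close> unfolding f_def
      by (cases "t < b") (auto simp: max_def min_def split: if_splits)
  qed
  have L_le: "L \<le> y \<longleftrightarrow> k a \<le> y \<and> (\<forall>r\<in>{a..<b}. \<psi> r \<le> y)" for y
    unfolding L_def using below by (subst cSup_le_iff) (auto intro!: bdd_aboveI2)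
  have "L \<le> m" using below \<open>k a \<le> m\<close> by (auto simp: L_le)
  have f_in: "f t = \<psi> t" if "t \<in> {a..b}" for t using that by (simp add: f_def)
  have f_lo: "f t = \<psi> a" if "t \<le> a" for t using that \<open>a < b\<close> by (simp add: f_def)
  have f_hi: "f t = \<psi> b" if "b \<le> t" for t using that \<open>a < b\<close> by (simp add: f_def)
  have R_le: "R t \<le> y \<longleftrightarrow> k a \<le> y \<and> (\<forall>r\<le>t. f r \<le> y)" for t y
    unfolding R_def by (rule running_sup_le_iff[OF bdd])
  have R_in: "R t = k t" if "t \<in> {a..<b}" for t
  proof -
    have "k t \<le> y \<longleftrightarrow> k a \<le> y \<and> (\<forall>r\<in>{a..t}. \<psi> r \<le> y)" for y
      using below that by (subst k, force, force, subst cSup_le_iff) (auto intro!: bdd_aboveI2[where M=m])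
    moreover have "(\<forall>r\<le>t. f r \<le> y) \<longleftrightarrow> (\<forall>r\<in>{a..t}. \<psi> r \<le> y)" for y
    proof
      assume *: "\<forall>r\<in>{a..t}. \<psi> r \<le> y"
      then have "f r \<le> y" if "r \<le> t" for r
        using that \<open>t \<in> {a..<b}\<close> f_in[of r] f_lo[of r] by (cases "a \<le> r") auto
      then show "\<forall>r\<le>t. f r \<le> y" by blast
    qed (use that f_in in force)
    ultimately have "R t \<le> y \<longleftrightarrow> k t \<le> y" for y by (simp add: R_le)
    then show ?thesis by (meson antisym order_refl)
  qed
  have R_lo: "R t = k a" if "t \<le> a" for t
  proof -
    have "R t \<le> y \<longleftrightarrow> k a \<le> y" for y
      using that f_lo \<open>\<psi> a \<le> k a\<close> by (auto simp: R_le)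
    then show ?thesis by (meson antisym order_refl)
  qed
  have R_hi: "R t = max L (\<psi> b)" if "b \<le> t" for t
  proof -
    have "R t \<le> y \<longleftrightarrow> max L (\<psi> b) \<le> y" for y
    proof
      assume *: "R t \<le> y"
      then have "\<psi> r \<le> y" if "r \<in> {a..b}" for r
        using that f_in[of r] spec[of "\<lambda>r. r \<le> t \<longrightarrow> f r \<le> y" r] \<open>b \<le> t\<close> by (auto simp: R_le)
      then show "max L (\<psi> b) \<le> y" using * \<open>a < b\<close> by (auto simp: R_le L_le)
    next
      assume "max L (\<psi> b) \<le> y"
      then have y: "k a \<le> y" "\<psi> b \<le> y" "\<And>r. r \<in> {a..<b} \<Longrightarrow> \<psi> r \<le> y" by (auto simp: L_le)
      have "f r \<le> y" for r
        using y \<open>a < b\<close> unfolding f_def by (auto simp: max_def min_def)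
      then show "R t \<le> y" using y by (simp add: R_le)
    qed
    then show ?thesis by (meson antisym order_refl)
  qed
  have rc_f: "continuous (at_right u) f" for u
  proof -
    consider "u < a" | "a \<le> u" "u < b" | "b \<le> u" by linarith
    then show ?thesis
    proof cases
      case 1
      then have ev: "\<forall>\<^sub>F v in at_right u. f v = \<psi> a"
        using f_lo by (auto simp: eventually_at_right_field intro!: exI[of _ a])
      show ?thesis
        by (rule continuous_at_right_if_eventually_eq[OF ev]) (use 1 f_lo[of u] in auto)
    next
      case 2
      then have ev: "\<forall>\<^sub>F v in at_right u. f v = \<psi> v"
        using f_in by (auto simp: eventually_at_right_field intro!: exI[of _ b])
      show ?thesis
        by (rule continuous_at_right_if_eventually_eq[OF ev]) (use 2 f_in[of u] rc[of u] in auto)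
    next
      case 3
      then have ev: "\<forall>\<^sub>F v in at_right u. f v = \<psi> b"
        using f_hi by (auto simp: eventually_at_right_field intro!: exI[of _ "u+1"])
      show ?thesis
        by (rule continuous_at_right_if_eventually_eq[OF ev]) (use 3 f_hi[of u] in auto)
    qed
  qed
  have rc_N: "continuous (at_right u) N" for u
  proof (cases "u < b")
    case True
    then have ev: "\<forall>\<^sub>F v in at_right u. N v = 0"
      by (auto simp: eventually_at_right_field N_def intro!: exI[of _ b])
    show ?thesis
      by (rule continuous_at_right_if_eventually_eq[OF ev]) (use True in \<open>auto simp: N_def\<close>)
  next
    case False
    then have ev: "\<forall>\<^sub>F v in at_right u. N v = J"
      by (auto simp: eventually_at_right_field N_def intro!: exI[of _ "u+1"])
    show ?thesis
      by (rule continuous_at_right_if_eventually_eq[OF ev]) (use False in \<open>auto simp: N_def\<close>)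
  qed
  have split: "k t - k a = R t - k a - N t" if "t \<in> {a..b}" for t
  proof (cases "t = b")
    case True
    then show ?thesis
      using R_hi[of b] kb \<open>\<psi> b \<le> \<phi> b\<close> \<open>\<psi> a \<le> k a\<close> unfolding N_def J_def L_def[symmetric]
      by (auto simp: max_def min_def)
  next
    case False
    then show ?thesis using that R_in[of t] by (simp add: N_def)
  qed
  have flatR: "flat_at R u" if "u \<in> {a..b}" "\<psi> u < k u" for u
  proof -
    have "f u < R u"
      using that R_in[of u] f_in[of u] R_hi[of b] kb unfolding L_def[symmetric]
      by (cases "u = b") (auto simp: max_def min_def split: if_splits)
    then show ?thesis unfolding R_def by (intro flat_at_running_sup[OF bdd rc_f])
  qed
  have flatN: "flat_at N u" if "u \<in> {a..b}" "k u < \<phi> u" for u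
  proof (cases "u = b")
    case True
    then have "J = 0" using that kb \<open>\<psi> b \<le> \<phi> b\<close>
      unfolding L_def[symmetric] J_def by (auto simp: max_def min_def split: if_splits)
    then show ?thesis by (intro flat_at_if_locally_const[where c=0]) (simp add: N_def)
  next
    case False
    have "\<forall>\<^sub>F v in nhds u. N v = 0"
      by (rule eventually_mono[OF eventually_nhds_in_open[of "{..<b}"]])
         (use False that in \<open>auto simp: N_def\<close>)
    then show ?thesis by (rule flat_at_if_locally_const)
  qed
  have "reflecting_split \<psi> \<phi> k a b (\<lambda>t. R t - k a) N"
    unfolding reflecting_split_def
  proof (intro conjI ballI allI impI)
    show "mono (\<lambda>t. R t - k a)"
      using mono_running_sup[OF bdd] unfolding R_def mono_def by simp
    show "mono N" by (auto simp: N_def J_def mono_def)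
    show "continuous (at_right u) (\<lambda>t. R t - k a)" for u
      unfolding R_def by (intro continuous_intros right_continuous_running_sup[OF bdd rc_f])
    show "R t - k a = 0" "N t = 0" if "t \<le> a" for t
      using that R_lo \<open>a < b\<close> by (auto simp: N_def)
    show "\<exists>p n. \<forall>t\<ge>b. R t - k a = p \<and> N t = n"
      using R_hi by (intro exI[of _ "max L (\<psi> b) - k a"] exI[of _ J]) (auto simp: N_def)
    show "flat_at (\<lambda>t. R t - k a) u" if "u \<in> {a..b}" "\<psi> u < k u" for u
      using flatR[OF that] by (rule flat_at_diff_const)
  qed (fact rc_N split flatN)+
  then show ?thesis by blast
qed

section \<open>The double reflection formula\<close>

text \<open>
  With \<open>c = - neg_part (\<phi> 0)\<close> and \<open>a = 0\<close> this is the formula for the constraining term. The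
  starting time and the starting value are parameters in order to express the flow property.
\<close>

definition double_reflection ::
  "(real \<Rightarrow> real) \<Rightarrow> (real \<Rightarrow> real) \<Rightarrow> real \<Rightarrow> real \<Rightarrow> real \<Rightarrow> real" where
  "double_reflection \<psi> \<phi> c a t =
     min (max c (SUP r\<in>{a..t}. \<psi> r)) (INF u\<in>{a..t}. max (\<phi> u) (SUP r\<in>{u..t}. \<psi> r))"

lemma le_double_reflection_iff:
  assumes "bdd_above (\<psi> ` {a..t})" "a \<le> t"
  shows "y \<le> double_reflection \<psi> \<phi> c a t \<longleftrightarrow>
    y \<le> max c (SUP r\<in>{a..t}. \<psi> r) \<and> (\<forall>u\<in>{a..t}. y \<le> max (\<phi> u) (SUP r\<in>{u..t}. \<psi> r))"
proof -
  have "\<psi> t \<le> max (\<phi> u) (SUP r\<in>{u..t}. \<psi> r)" if "u \<in> {a..t}" for u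
    using that assms
    by (intro max.coboundedI2 cSUP_upper bdd_above_mono[OF assms(1)]) auto
  then have "bdd_below ((\<lambda>u. max (\<phi> u) (SUP r\<in>{u..t}. \<psi> r)) ` {a..t})"
    by (rule bdd_belowI2)
  then show ?thesis
    using assms(2) unfolding double_reflection_def by (simp add: le_cINF_iff)
qed

lemma SUP_Icc_split:
  fixes \<psi> :: "real \<Rightarrow> real"
  assumes "bdd_above (\<psi> ` {a..t})" "a \<le> u" "u \<le> b" "b \<le> t"
  shows "(SUP r\<in>{u..t}. \<psi> r) = max (SUP r\<in>{u..b}. \<psi> r) (SUP r\<in>{b..t}. \<psi> r)"
proof -
  have "{u..t} = {u..b} \<union> {b..t}" using assms by auto
  moreover have "bdd_above (\<psi> ` {u..b})" "bdd_above (\<psi> ` {b..t})"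
    using assms by (auto intro!: bdd_above_mono[OF assms(1)])
  ultimately show ?thesis using assms by (simp add: cSUP_union sup_max)
qed

text \<open>
  The formula restarted at time \<open>b\<close> from the value reached then. The suprema over \<open>[u,t]\<close> with
  \<open>u \<le> b\<close> factor through the supremum over \<open>[b,t]\<close>, and finite maxima commute with the infimum over
  \<open>[a,b]\<close>; comparing which numbers \<open>y\<close> lie below either side turns this into propositional logic.
\<close>

lemma double_reflection_flow:
  assumes bdd: "bdd_above (\<psi> ` {a..t})" and "a \<le> b" "b \<le> t"
  shows "double_reflection \<psi> \<phi> c a t =
    double_reflection \<psi> \<phi> (double_reflection \<psi> \<phi> c a b) b t"
proof -
  have bdd': "bdd_above (\<psi> ` {a..b})" "bdd_above (\<psi> ` {b..t})"
    using assms by (auto intro!: bdd_above_mono[OF bdd])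
  have "y \<le> double_reflection \<psi> \<phi> c a t \<longleftrightarrow>
    y \<le> double_reflection \<psi> \<phi> (double_reflection \<psi> \<phi> c a b) b t" for y
  proof -
    let ?S = "\<lambda>u t. SUP r\<in>{u..t}. \<psi> r"
    have S: "?S u t = max (?S u b) (?S b t)" if "u \<in> {a..b}" for u
      using that assms by (intro SUP_Icc_split[OF bdd]) auto
    have "{a..t} = {a..b} \<union> {b..t}" using assms by auto
    then have "y \<le> double_reflection \<psi> \<phi> c a t \<longleftrightarrow>
        y \<le> max c (?S a t) \<and> (\<forall>u\<in>{a..b}. y \<le> max (\<phi> u) (?S u t)) \<and>
        (\<forall>u\<in>{b..t}. y \<le> max (\<phi> u) (?S u t))"
      using le_double_reflection_iff[OF bdd order_trans[OF \<open>a \<le> b\<close> \<open>b \<le> t\<close>], of y \<phi> c]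
      by (simp only: ball_Un)
    also have "\<dots> \<longleftrightarrow> y \<le> max c (max (?S a b) (?S b t)) \<and>
        (\<forall>u\<in>{a..b}. y \<le> max (\<phi> u) (max (?S u b) (?S b t))) \<and>
        (\<forall>u\<in>{b..t}. y \<le> max (\<phi> u) (?S u t))"
    proof -
      have "?S a t = max (?S a b) (?S b t)" by (rule S) (use assms in simp)
      moreover have "(\<forall>u\<in>{a..b}. y \<le> max (\<phi> u) (?S u t)) \<longleftrightarrow>
          (\<forall>u\<in>{a..b}. y \<le> max (\<phi> u) (max (?S u b) (?S b t)))"
        by (rule ball_cong[OF refl]) (simp only: S)
      ultimately show ?thesis by (simp only:)
    qed
    also have "\<dots> \<longleftrightarrow> (y \<le> double_reflection \<psi> \<phi> c a b \<or> y \<le> ?S b t) \<and>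
        (\<forall>u\<in>{b..t}. y \<le> max (\<phi> u) (?S u t))"
      unfolding le_double_reflection_iff[OF bdd'(1) \<open>a \<le> b\<close>] le_max_iff_disj by blast
    also have "\<dots> \<longleftrightarrow> y \<le> double_reflection \<psi> \<phi> (double_reflection \<psi> \<phi> c a b) b t"
      unfolding le_double_reflection_iff[OF bdd'(2) \<open>b \<le> t\<close>] le_max_iff_disj ..
    finally show ?thesis .
  qed
  then show ?thesis by (meson antisym order_refl)
qed

lemma double_reflection_bounds:
  assumes "bdd_above (\<psi> ` {a..t})" "a \<le> t" "\<psi> t \<le> \<phi> t"
  shows "\<psi> t \<le> double_reflection \<psi> \<phi> c a t" "double_reflection \<psi> \<phi> c a t \<le> \<phi> t"
proof -
  have SUP: "\<psi> t \<le> (SUP r\<in>{u..t}. \<psi> r)" if "u \<in> {a..t}" for u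
    using that assms by (intro cSUP_upper bdd_above_mono[OF assms(1)]) auto
  then have lower: "\<psi> t \<le> max (\<phi> u) (SUP r\<in>{u..t}. \<psi> r)" if "u \<in> {a..t}" for u
    using that by (simp add: le_max_iff_disj)
  then have "\<psi> t \<le> (INF u\<in>{a..t}. max (\<phi> u) (SUP r\<in>{u..t}. \<psi> r))"
    using assms(2) by (intro cINF_greatest) auto
  moreover have "\<psi> t \<le> max c (SUP r\<in>{a..t}. \<psi> r)"
    using SUP[of a] assms(2) by (simp add: le_max_iff_disj)
  ultimately show "\<psi> t \<le> double_reflection \<psi> \<phi> c a t"
    by (simp add: double_reflection_def)
  have "(INF u\<in>{a..t}. max (\<phi> u) (SUP r\<in>{u..t}. \<psi> r)) \<le> max (\<phi> t) (SUP r\<in>{t..t}. \<psi> r)"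
    using assms(2) lower by (intro cINF_lower bdd_belowI2[where m="\<psi> t"]) auto
  then show "double_reflection \<psi> \<phi> c a t \<le> \<phi> t"
    using assms(3) by (simp add: double_reflection_def min_le_iff_disj)
qed

text \<open>
  Where a level \<open>m\<close> separates the barriers, the formula collapses to a one-sided one: \<open>k\<close> is the
  running maximum of \<open>k a\<close> and \<open>\<psi>\<close> if it starts below \<open>m\<close>, and the running minimum of \<open>k a\<close>
  and \<open>\<phi>\<close> if it starts above. Separation is asked for on \<open>[a,b)\<close> only, so that
  \<open>b\<close> may be a jump time of the barriers.
\<close>

lemma double_reflection_split_separated:
  assumes "a < b"
    and rc: "\<And>u. a \<le> u \<Longrightarrow> u < b \<Longrightarrow> continuous (at_right u) \<psi> \<and> continuous (at_right u) \<phi>"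
    and sep: "\<And>u. a \<le> u \<Longrightarrow> u < b \<Longrightarrow> \<psi> u < m \<and> m < \<phi> u"
    and b: "\<psi> b \<le> \<phi> b"
    and k: "\<And>t. a \<le> t \<Longrightarrow> t \<le> b \<Longrightarrow> k t = double_reflection \<psi> \<phi> (k a) a t"
  shows "\<exists>P N. reflecting_split \<psi> \<phi> k a b P N"
proof -
  have bdd: "bdd_above (\<psi> ` {u..t})" if "a \<le> u" "t \<le> b" for u t
  proof (rule bdd_aboveI2)
    fix r assume "r \<in> {u..t}"
    then show "\<psi> r \<le> max m (\<psi> b)" using sep[of r] that by (cases "r = b") auto
  qed
  have SUP_upper: "\<psi> r \<le> (SUP r\<in>{u..t}. \<psi> r)" if "a \<le> u" "u \<le> r" "r \<le> t" "t \<le> b" for u r t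
    using that by (intro cSUP_upper bdd) auto
  have SUP_le: "(SUP r\<in>{u..t}. \<psi> r) \<le> m" if "a \<le> u" "u \<le> t" "t < b" for u t
    using that sep by (intro cSUP_least) (auto intro: less_imp_le)
  have SUP_b: "(SUP r\<in>{u..b}. \<psi> r) \<le> max m (\<psi> b)" if "a \<le> u" "u \<le> b" for u
  proof (rule cSUP_least)
    fix r assume "r \<in> {u..b}"
    then show "\<psi> r \<le> max m (\<psi> b)" using sep[of r] that by (cases "r = b") auto
  qed (use that in auto)
  have k_ge: "y \<le> k t \<longleftrightarrow> y \<le> max (k a) (SUP r\<in>{a..t}. \<psi> r) \<and>
      (\<forall>u\<in>{a..t}. y \<le> max (\<phi> u) (SUP r\<in>{u..t}. \<psi> r))" if "a \<le> t" "t \<le> b" for t y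
    using k[OF that] le_double_reflection_iff[OF bdd] that by simp
  have ka: "\<psi> a \<le> k a" "k a \<le> \<phi> a"
    using double_reflection_bounds[OF bdd, of a a \<phi> "k a"] sep[of a] \<open>a < b\<close>
    unfolding k[of a, OF order_refl less_imp_le[OF \<open>a < b\<close>], symmetric] by auto
  have kb: "k b \<le> \<phi> b"
    using double_reflection_bounds(2)[OF bdd, of a b \<phi> "k a"] b \<open>a < b\<close>
    unfolding k[of b, OF less_imp_le[OF \<open>a < b\<close>] order_refl, symmetric] by auto
  show ?thesis
  proof (cases "k a \<le> m")
    case True
    show ?thesis
    proof (rule reflecting_split_below_level[OF \<open>a < b\<close>, where m=m])
      fix t assume t: "a \<le> t" "t < b"
      have "k t = max (k a) (SUP r\<in>{a..t}. \<psi> r)"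
      proof (rule antisym)
        show "k t \<le> max (k a) (SUP r\<in>{a..t}. \<psi> r)" using k_ge[of t "k t"] t by simp
        have *: "max (k a) (SUP r\<in>{a..t}. \<psi> r) \<le> m" using SUP_le[of a t] True t by simp
        have "max (k a) (SUP r\<in>{a..t}. \<psi> r) \<le> max (\<phi> u) (SUP r\<in>{u..t}. \<psi> r)" if "u \<in> {a..t}" for u
        proof (rule max.coboundedI1[OF order_trans[OF *]])
          show "m \<le> \<phi> u" using sep[of u] that t by simp
        qed
        then show "max (k a) (SUP r\<in>{a..t}. \<psi> r) \<le> k t"
          using k_ge t less_imp_le by blast
      qed
      also have "\<dots> = Sup (insert (k a) (\<psi> ` {a..t}))"
        using t bdd[of a t] by (subst cSup_insert) (auto simp: sup_max)
      finally show "k t = Sup (insert (k a) (\<psi> ` {a..t}))" .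
    next
      define L where "L = Sup (insert (k a) (\<psi> ` {a..<b}))"
      have bdd_L: "bdd_above (\<psi> ` {a..<b})"
        by (rule bdd_above_mono[OF bdd[of a b]]) auto
      have "L \<le> m" unfolding L_def
        using sep True by (intro cSup_least) (auto intro: less_imp_le)
      \<comment> \<open>separate the last value of \<open>\<psi>\<close>, a possible jump, from those that determine the left limit \<open>L\<close>\<close>
      have "insert (k a) (\<psi> ` {a..b}) = insert (\<psi> b) (insert (k a) (\<psi> ` {a..<b}))"
        using \<open>a < b\<close> by (force simp: less_le)
      then have "max (k a) (SUP r\<in>{a..b}. \<psi> r) = Sup (insert (\<psi> b) (insert (k a) (\<psi> ` {a..<b})))"
        using bdd[of a b] \<open>a < b\<close> cSup_insert[of "\<psi> ` {a..b}" "k a"] by (auto simp: sup_max)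
      also have "\<dots> = max (\<psi> b) L"
        using bdd_L unfolding L_def by (subst cSup_insert) (auto simp: sup_max)
      finally have max_L: "max (k a) (SUP r\<in>{a..b}. \<psi> r) = max (\<psi> b) L" .
      have "k b = min (max (\<psi> b) L) (\<phi> b)"
      proof (rule antisym)
        show "k b \<le> min (max (\<psi> b) L) (\<phi> b)"
          using k_ge[of b "k b"] \<open>a < b\<close> kb max_L by simp
        have "min (max (\<psi> b) L) (\<phi> b) \<le> max (\<phi> u) (SUP r\<in>{u..b}. \<psi> r)" if "u \<in> {a..b}" for u
          using that SUP_upper[of u b b] sep[of u] \<open>L \<le> m\<close> by (cases "u = b") auto
        then show "min (max (\<psi> b) L) (\<phi> b) \<le> k b"
          using \<open>a < b\<close> max_L by (subst k_ge) auto
      qed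
      then show "k b = max (\<psi> b) (min (\<phi> b) (Sup (insert (k a) (\<psi> ` {a..<b}))))"
        using b unfolding L_def[symmetric] by (auto simp: max_def min_def)
    qed (use rc sep b ka True in \<open>auto intro: less_imp_le\<close>)
  next
    case False
    \<comment> \<open>above the level only the upper barrier acts; reflecting the picture returns to the case below the level\<close>
    have "\<exists>P N. reflecting_split (\<lambda>t. - \<phi> t) (\<lambda>t. - \<psi> t) (\<lambda>t. - k t) a b P N"
    proof (rule reflecting_split_below_level[OF \<open>a < b\<close>, where m="-m"])
      fix t assume t: "a \<le> t" "t < b"
      have bdd_\<phi>: "bdd_above ((\<lambda>t. - \<phi> t) ` {a..t})"
        using sep t by (intro bdd_aboveI2[where M="-m"]) (auto intro: less_imp_le)
      have "- k t \<le> y \<longleftrightarrow> Sup (insert (- k a) ((\<lambda>t. - \<phi> t) ` {a..t})) \<le> y" for y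
      proof -
        have "- k t \<le> y \<longleftrightarrow> - y \<le> k t" by auto
        also have "\<dots> \<longleftrightarrow> - y \<le> k a \<and> (\<forall>u\<in>{a..t}. - y \<le> \<phi> u)"
        proof -
          have "max (k a) (SUP r\<in>{a..t}. \<psi> r) = k a" using SUP_le[of a t] False t by simp
          moreover have "max (\<phi> u) (SUP r\<in>{u..t}. \<psi> r) = \<phi> u" if "u \<in> {a..t}" for u
            using SUP_le[of u t] sep[of u] t that by simp
          ultimately show ?thesis using k_ge[of t "- y"] t by simp
        qed
        also have "\<dots> \<longleftrightarrow> Sup (insert (- k a) ((\<lambda>t. - \<phi> t) ` {a..t})) \<le> y"
          using bdd_\<phi> t by (subst cSup_le_iff) auto
        finally show ?thesis .
      qed
      then show "- k t = Sup (insert (- k a) ((\<lambda>t. - \<phi> t) ` {a..t}))"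
        by (meson antisym order_refl)
    next
      define L where "L = Sup (insert (- k a) ((\<lambda>t. - \<phi> t) ` {a..<b}))"
      have bdd_\<phi>: "bdd_above ((\<lambda>t. - \<phi> t) ` {a..<b})"
        using sep by (intro bdd_aboveI2[where M="-m"]) (auto intro: less_imp_le)
      have "- k b \<le> y \<longleftrightarrow> max (- \<phi> b) (min (- \<psi> b) L) \<le> y" for y
      proof -
        have "- k b \<le> y \<longleftrightarrow> - y \<le> k b" by auto
        also have "\<dots> \<longleftrightarrow> (- y \<le> \<psi> b \<or> - y \<le> k a) \<and> - y \<le> \<phi> b \<and>
            (\<forall>u\<in>{a..<b}. - y \<le> \<phi> u \<or> - y \<le> \<psi> b)"
        proof -
          have "max (k a) (SUP r\<in>{a..b}. \<psi> r) = max (\<psi> b) (k a)"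
            using SUP_b[of a] SUP_upper[of a b b] False \<open>a < b\<close> by (auto simp: max_def split: if_splits)
          moreover have SUP_u: "max (\<phi> u) (SUP r\<in>{u..b}. \<psi> r) = max (\<phi> u) (\<psi> b)" if "u \<in> {a..<b}" for u
            using SUP_b[of u] SUP_upper[of u b b] sep[of u] \<open>a < b\<close> that
            by (auto simp: max_def split: if_splits)
          moreover have "(\<forall>u\<in>{a..b}. - y \<le> max (\<phi> u) (SUP r\<in>{u..b}. \<psi> r)) \<longleftrightarrow>
              - y \<le> \<phi> b \<and> (\<forall>u\<in>{a..<b}. - y \<le> max (\<phi> u) (\<psi> b))"
          proof -
            have Icc: "{a..b} = insert b {a..<b}" using \<open>a < b\<close> by auto
            have "max (\<phi> b) (SUP r\<in>{b..b}. \<psi> r) = \<phi> b" using b by simp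
            then show ?thesis using SUP_u unfolding Icc ball_simps(7) by metis
          qed
          ultimately show ?thesis
            using \<open>a < b\<close> k_ge[of b "- y"] by (simp only: le_max_iff_disj order_refl less_imp_le)
        qed
        also have "\<dots> \<longleftrightarrow> - \<phi> b \<le> y \<and> (- \<psi> b \<le> y \<or> - k a \<le> y \<and> (\<forall>u\<in>{a..<b}. - \<phi> u \<le> y))"
          by (auto simp: minus_le_iff)
        also have "\<dots> \<longleftrightarrow> - \<phi> b \<le> y \<and> (- \<psi> b \<le> y \<or> L \<le> y)"
          using bdd_\<phi> unfolding L_def by (subst cSup_le_iff) auto
        also have "\<dots> \<longleftrightarrow> max (- \<phi> b) (min (- \<psi> b) L) \<le> y"
          by (simp add: min_le_iff_disj)
        finally show ?thesis .
      qed
      then show "- k b = max (- \<phi> b) (min (- \<psi> b) (Sup (insert (- k a) ((\<lambda>t. - \<phi> t) ` {a..<b}))))"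
        unfolding L_def by (meson antisym order_refl)
    qed (use rc sep b ka False in \<open>auto intro: less_imp_le continuous_minus\<close>)
    then show ?thesis using reflecting_split_uminus by blast
  qed
qed

lemma Dspace_right: "f \<in> Dspace \<Longrightarrow> 0 \<le> t \<Longrightarrow> (f \<longlongrightarrow> f t) (at_right t)"
  by (simp add: Dspace_def continuous_within)

lemma Dspace_left:
  assumes "f \<in> Dspace" "0 < t" obtains l where "(f \<longlongrightarrow> l) (at_left t)"
  using assms by (auto simp: Dspace_def)

text \<open>
  One-sided limits bound \<open>f\<close> near every point, and a bisection argument makes the bound uniform on
  compact intervals.
\<close>

lemma bdd_above_Dspace:
  assumes f: "f \<in> Dspace" and "0 \<le> a"
  shows "bdd_above (f ` {a..b})"
proof (cases "a \<le> b")
  case True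
  then have "0 \<le> a \<longrightarrow> bdd_above (f ` {a..b})"
  proof (induction rule: Bolzano)
    case (trans a b c)
    then have "{a..c} = {a..b} \<union> {b..c}" by auto
    then show ?case using trans by (auto simp: image_Un)
  next
    case (local x)
    then have "x \<ge> 0" using \<open>0 \<le> a\<close> by simp
    have "\<forall>\<^sub>F v in at_right x. f v < f x + 1"
      using Dspace_right[OF f \<open>x \<ge> 0\<close>] by (rule order_tendstoD) simp
    then obtain r where r: "r > x" "\<And>v. x < v \<Longrightarrow> v < r \<Longrightarrow> f v < f x + 1"
      by (auto simp: eventually_at_right_field)
    obtain l M where l: "l < x" "\<And>v. 0 \<le> v \<Longrightarrow> l < v \<Longrightarrow> v < x \<Longrightarrow> f v < M"
    proof (cases "x = 0")
      case True
      then show ?thesis using that[of "-1"] by auto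
    next
      case False
      then obtain L where L: "(f \<longlongrightarrow> L) (at_left x)"
        using Dspace_left[OF f, of x] \<open>x \<ge> 0\<close> by auto
      have "\<forall>\<^sub>F v in at_left x. f v < L + 1" using L by (rule order_tendstoD) simp
      then show ?thesis using that by (auto simp: eventually_at_left_field)
    qed
    have "bdd_above (f ` {a..b})" if "0 \<le> a" "a \<le> x" "x \<le> b" "b - a < min (r - x) (x - l)" for a b
    proof (rule bdd_aboveI2)
      fix v assume v: "v \<in> {a..b}"
      consider "v < x" | "v = x" | "x < v" by linarith
      then show "f v \<le> max (f x + 1) M"
        using r(2)[of v] l(2)[of v] v that by cases auto
    qed
    then show ?case using r(1) l(1) by (intro exI[of _ "min (r - x) (x - l)"]) auto
  qed
  then show ?thesis using \<open>0 \<le> a\<close> by simp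
qed simp

text \<open>
  Since the barriers are a distance \<open>\<delta>\<close> apart, so are their one-sided limits. Hence every time
  has a neighbourhood on the right, and a punctured one on the left, in which a level separates the barriers.
  Bisection and the flow property extend the split from these neighbourhoods to every compact interval.
\<close>

lemma double_reflection_split:
  assumes \<psi>: "\<psi> \<in> Dspace" and \<phi>: "\<phi> \<in> Dspace"
    and gap: "0 < \<delta>" "\<And>t. 0 \<le> t \<Longrightarrow> \<psi> t + \<delta> \<le> \<phi> t"
    and k: "\<And>t. 0 \<le> t \<Longrightarrow> k t = double_reflection \<psi> \<phi> c 0 t"
    and "0 \<le> a" "a \<le> b"
  shows "\<exists>P N. reflecting_split \<psi> \<phi> k a b P N"
proof -
  have flow: "k t = double_reflection \<psi> \<phi> (k a) a t" if "0 \<le> a" "a \<le> t" for a t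
    using double_reflection_flow[OF bdd_above_Dspace[OF \<psi>, of 0 t], of a \<phi> c] k that by simp
  have piece: "\<exists>P N. reflecting_split \<psi> \<phi> k a b P N"
    if "0 \<le> a" "a \<le> b" "\<And>u. a \<le> u \<Longrightarrow> u < b \<Longrightarrow> \<psi> u < m \<and> m < \<phi> u" for a b m
  proof (cases "a = b")
    case True
    then show ?thesis using reflecting_split_refl by blast
  next
    case False
    show ?thesis
    proof (rule double_reflection_split_separated[where m=m])
      show "k t = double_reflection \<psi> \<phi> (k a) a t" if "a \<le> t" for t
        using flow \<open>0 \<le> a\<close> that by blast
    qed (use that gap(1) gap(2)[of b] \<psi> \<phi> False in \<open>auto simp: Dspace_def\<close>)
  qed
  from \<open>a \<le> b\<close> have "0 \<le> a \<longrightarrow> (\<exists>P N. reflecting_split \<psi> \<phi> k a b P N)"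
  proof (induction rule: Bolzano)
    case (trans a b c)
    show ?case
    proof
      assume "0 \<le> a"
      then obtain P N P' N' where "reflecting_split \<psi> \<phi> k a b P N" "reflecting_split \<psi> \<phi> k b c P' N'"
        using trans by force
      then show "\<exists>P N. reflecting_split \<psi> \<phi> k a c P N"
        using reflecting_split_join trans by blast
    qed
  next
    case (local x)
    then have "x \<ge> 0" using \<open>0 \<le> a\<close> by simp
    define m where "m = (\<psi> x + \<phi> x) / 2"
    have m: "\<psi> x < m" "m < \<phi> x" using gap(1) gap(2)[OF \<open>x \<ge> 0\<close>] by (auto simp: m_def)
    have "\<forall>\<^sub>F v in at_right x. \<psi> v < m \<and> m < \<phi> v"
      using order_tendstoD[OF Dspace_right[OF \<psi> \<open>x \<ge> 0\<close>]] order_tendstoD[OF Dspace_right[OF \<phi> \<open>x \<ge> 0\<close>]] m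
      by (intro eventually_conj) auto
    then obtain r where r: "r > x" "\<And>v. x < v \<Longrightarrow> v < r \<Longrightarrow> \<psi> v < m \<and> m < \<phi> v"
      by (auto simp: eventually_at_right_field)
    have right: "\<exists>P N. reflecting_split \<psi> \<phi> k x b P N" if "x \<le> b" "b < r" for b
    proof (rule piece[where m=m, OF \<open>x \<ge> 0\<close> \<open>x \<le> b\<close>])
      fix u assume "x \<le> u" "u < b"
      then show "\<psi> u < m \<and> m < \<phi> u" using r(2)[of u] m that by (cases "u = x") auto
    qed
    \<comment> \<open>time 0 has no left neighbourhood in \<open>[0,\<infinity>)\<close>; there only the trivial interval is needed\<close>
    obtain l where l: "l < x" "\<And>a. 0 \<le> a \<Longrightarrow> l < a \<Longrightarrow> a \<le> x \<Longrightarrow> \<exists>P N. reflecting_split \<psi> \<phi> k a x P N"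
    proof (cases "x = 0")
      case True
      have "\<exists>P N. reflecting_split \<psi> \<phi> k a x P N" if "0 \<le> a" "a \<le> x" for a
        using that True reflecting_split_refl[of \<psi> \<phi> k 0] by (auto simp: order_antisym)
      then show ?thesis using that[of "-1"] True by auto
    next
      case False
      then have "0 < x" using \<open>x \<ge> 0\<close> by simp
      obtain y where y: "(\<psi> \<longlongrightarrow> y) (at_left x)" using Dspace_left[OF \<psi> \<open>0 < x\<close>] .
      obtain z where z: "(\<phi> \<longlongrightarrow> z) (at_left x)" using Dspace_left[OF \<phi> \<open>0 < x\<close>] .
      have "\<forall>\<^sub>F v in at_left x. \<psi> v + \<delta> \<le> \<phi> v"
        unfolding eventually_at_left_field using \<open>0 < x\<close> gap(2) less_imp_le by blast
      then have "y + \<delta> \<le> z"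
        using tendsto_le[OF trivial_limit_at_left_real z tendsto_add[OF y tendsto_const]] by blast
      define m where "m = (y + z) / 2"
      have m: "y < m" "m < z" using \<open>y + \<delta> \<le> z\<close> gap(1) by (auto simp: m_def)
      have "\<forall>\<^sub>F v in at_left x. \<psi> v < m \<and> m < \<phi> v"
        using order_tendstoD[OF y] order_tendstoD[OF z] m by (intro eventually_conj) auto
      then obtain l where "l < x" "\<And>v. l < v \<Longrightarrow> v < x \<Longrightarrow> \<psi> v < m \<and> m < \<phi> v"
        by (auto simp: eventually_at_left_field)
      then show ?thesis using piece[where m=m] by (intro that[of l]) auto
    qed
    have "\<exists>P N. reflecting_split \<psi> \<phi> k a b P N"
      if "0 \<le> a" "a \<le> x" "x \<le> b" "b - a < min (r - x) (x - l)" for a b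
    proof -
      have "l < a" "b < r" using that by auto
      then obtain P N P' N' where "reflecting_split \<psi> \<phi> k a x P N" "reflecting_split \<psi> \<phi> k x b P' N'"
        using l(2)[OF \<open>0 \<le> a\<close> _ \<open>a \<le> x\<close>] right[OF \<open>x \<le> b\<close>] by blast
      then show ?thesis using reflecting_split_join that by blast
    qed
    moreover have "0 < min (r - x) (x - l)" using r(1) l(1) by simp
    ultimately show ?case by blast
  qed
  then show ?thesis using \<open>0 \<le> a\<close> by (rule mp)
qed

section \<open>Stieltjes measures and flat points\<close>

text \<open>
  Open intervals attached to the points of \<open>A\<close> on their right. By Lindelof countably many of them
  have the same union as all of them. The points of \<open>A\<close> outside that union are countably many,
  since the intervals starting at them are pairwise disjoint.
\<close>

lemma half_open_cover:
  fixes \<beta> :: "real \<Rightarrow> real"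
  assumes \<beta>: "\<And>u. u \<in> A \<Longrightarrow> u < \<beta> u"
  obtains B C where "B \<subseteq> A" "countable B" "C \<subseteq> A" "countable C"
    "A \<subseteq> (\<Union>u\<in>B. {u<..<\<beta> u}) \<union> C"
proof -
  define C where "C = A - (\<Union>u\<in>A. {u<..<\<beta> u})"
  obtain B where B: "B \<subseteq> A" "countable B" "(\<Union>u\<in>B. {u<..<\<beta> u}) = (\<Union>u\<in>A. {u<..<\<beta> u})"
  proof -
    have "open S" if "S \<in> (\<lambda>u. {u<..<\<beta> u}) ` A" for S using that by auto
    then obtain I where I: "I \<subseteq> (\<lambda>u. {u<..<\<beta> u}) ` A" "countable I"
      "\<Union>I = \<Union>((\<lambda>u. {u<..<\<beta> u}) ` A)"
      using Lindelof[of "(\<lambda>u. {u<..<\<beta> u}) ` A"] by metis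
    obtain B where "countable B" "B \<subseteq> A" "I = (\<lambda>u. {u<..<\<beta> u}) ` B"
      using I(1,2) countable_subset_image[of I "\<lambda>u. {u<..<\<beta> u}" A] by metis
    then show ?thesis using that[of B] I(3) by simp
  qed
  have "countable C"
  proof -
    have "\<exists>q. u < of_rat q \<and> of_rat q < \<beta> u" if "u \<in> A" for u
      using \<beta>[OF that] of_rat_dense by blast
    \<comment> \<open>a rational in each interval; on \<open>C\<close> the intervals are disjoint, which makes the choice injective\<close>
    then obtain q where q: "\<And>u. u \<in> A \<Longrightarrow> u < of_rat (q u) \<and> of_rat (q u) < \<beta> u" by metis
    have less: "q u < q v" if "u \<in> C" "v \<in> C" "u < v" for u v
    proof -
      have A: "u \<in> A" "v \<in> A" using that by (auto simp: C_def)
      moreover have "\<beta> u \<le> v" using that A by (force simp: C_def)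
      ultimately have "real_of_rat (q u) < real_of_rat (q v)"
        using q[of u] q[of v] by linarith
      then show ?thesis by (simp add: of_rat_less)
    qed
    have "inj_on q C"
    proof (rule inj_onI)
      fix u v assume "u \<in> C" "v \<in> C" "q u = q v"
      then show "u = v" using less[of u v] less[of v u] by (cases u v rule: linorder_cases) auto
    qed
    then show ?thesis
      by (meson countable_image_inj_on countableI_type countable_subset subset_UNIV)
  qed
  have "A \<subseteq> (\<Union>u\<in>B. {u<..<\<beta> u}) \<union> C"
    unfolding B(3) C_def Un_Diff_cancel by (rule Un_upper2)
  then show thesis using that[OF B(1,2) _ \<open>countable C\<close>] by (simp add: C_def)
qed

lemma interval_measure_singleton_null:
  assumes F: "mono F" "\<And>u. continuous (at_right u) F" and "isCont F u"
  shows "{u} \<in> null_sets (interval_measure F)"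
proof -
  have small: "emeasure (interval_measure F) {u} \<le> ennreal e" if "e > 0" for e
  proof -
    have "(F \<longlongrightarrow> F u) (at_left u)"
      using \<open>isCont F u\<close> by (simp add: isCont_def filterlim_at_split)
    then have "\<forall>\<^sub>F v in at_left u. F u - e < F v"
      using \<open>e > 0\<close> by (intro order_tendstoD(1)) auto
    then obtain a where "a < u" "\<And>v. a < v \<Longrightarrow> v < u \<Longrightarrow> F u - e < F v"
      by (auto simp: eventually_at_left_field)
    then obtain v where v: "v < u" "F u - e < F v" using dense by blast
    have "emeasure (interval_measure F) {u} \<le> emeasure (interval_measure F) {v<..u}"
      using v by (intro emeasure_mono) auto
    also have "\<dots> = ennreal (F u - F v)"
      using v F by (intro emeasure_interval_measure_Ioc) (auto simp: mono_def)
    also have "\<dots> \<le> ennreal e" using v by (intro ennreal_leI) simp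
    finally show ?thesis .
  qed
  have "emeasure (interval_measure F) {u} \<le> 0"
    by (rule ennreal_le_epsilon) (simp add: small)
  then show ?thesis by (simp add: null_sets_def)
qed

text \<open>
  Each flat point is the left endpoint of an interval on which \<open>F\<close> is constant. Covering the flat points by
  countably many of these intervals and countably many further points, which carry no atoms, shows
  that they form a null set.
\<close>

lemma nn_integral_flat_eq_0:
  assumes F: "mono F" "\<And>u. continuous (at_right u) F"
    and flat: "\<And>u. 0 \<le> u \<Longrightarrow> u \<in> S \<Longrightarrow> flat_at F u"
  shows "(\<integral>\<^sup>+u\<in>{0..}. indicator S u \<partial>interval_measure F) = 0"
proof -
  define A where "A = {0..} \<inter> S"
  have flat_A: "flat_at F u" if "u \<in> A" for u using flat that by (simp add: A_def)
  have "\<exists>b>u. F b = F u" if "u \<in> A" for u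
  proof -
    have "\<forall>\<^sub>F v in at_right u. F v = F u" using flat_A[OF that] by (simp add: flat_at_def)
    then obtain b where "b > u" "\<And>v. u < v \<Longrightarrow> v < b \<Longrightarrow> F v = F u"
      by (auto simp: eventually_at_right_field)
    then show ?thesis using dense[of u b] by blast
  qed
  then obtain \<beta> where \<beta>: "\<And>u. u \<in> A \<Longrightarrow> \<beta> u > u \<and> F (\<beta> u) = F u" by metis
  obtain B C where BC: "B \<subseteq> A" "countable B" "C \<subseteq> A" "countable C"
      "A \<subseteq> (\<Union>u\<in>B. {u<..<\<beta> u}) \<union> C"
    by (rule half_open_cover[of A \<beta>]) (use \<beta> in blast)
  have "{u<..<\<beta> u} \<in> null_sets (interval_measure F)" if "u \<in> B" for u
  proof (rule null_sets_subset)
    have u: "u < \<beta> u" "F (\<beta> u) = F u" using \<beta> BC(1) that by auto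
    then have "emeasure (interval_measure F) {u<..\<beta> u} = ennreal (F (\<beta> u) - F u)"
      using F by (intro emeasure_interval_measure_Ioc) (auto simp: mono_def)
    then show "{u<..\<beta> u} \<in> null_sets (interval_measure F)" using u by (simp add: null_sets_def)
  qed auto
  moreover have "{u} \<in> null_sets (interval_measure F)" if "u \<in> C" for u
    using flat_A[of u] BC(3) that
    by (intro interval_measure_singleton_null F) (auto simp: flat_at_def)
  ultimately have null: "(\<Union>u\<in>B. {u<..<\<beta> u}) \<union> (\<Union>u\<in>C. {u}) \<in> null_sets (interval_measure F)"
    using BC(2,4) by (intro null_sets.Un null_sets_UN')
  have "AE u in interval_measure F. indicator S u * indicator {0..} u = (0 :: ennreal)"
  proof (rule AE_I'[OF null])
    show "{u \<in> space (interval_measure F). indicator S u * indicator {0..} u \<noteq> (0 :: ennreal)}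
        \<subseteq> (\<Union>u\<in>B. {u<..<\<beta> u}) \<union> (\<Union>u\<in>C. {u})"
      unfolding UN_singleton using BC(5) by (auto simp: A_def indicator_def split: if_splits)
  qed
  then have "(\<integral>\<^sup>+u\<in>{0..}. indicator S u \<partial>interval_measure F) = (\<integral>\<^sup>+u. 0 \<partial>interval_measure F)"
    by (rule nn_integral_cong_AE)
  then show ?thesis by simp
qed

lemma interval_measure_null_Ioc:
  assumes F: "mono F" "\<And>u. continuous (at_right u) F"
    and "a \<le> b" "emeasure (interval_measure F) {a<..b} = 0"
  shows "F b = F a"
proof -
  have "emeasure (interval_measure F) {a<..b} = ennreal (F b - F a)"
    using assms by (intro emeasure_interval_measure_Ioc) (auto simp: mono_def)
  then show ?thesis using assms monoD[OF F(1), of a b] by (simp add: ennreal_eq_0_iff)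
qed

text \<open>
  Besides growth inside the interval, a null closed interval excludes an atom at its left endpoint, so
  \<open>F b\<close> is approached by values of \<open>F\<close> before \<open>a\<close>.
\<close>

lemma interval_measure_null_Icc:
  assumes F: "mono F" "\<And>u. continuous (at_right u) F"
    and "a \<le> b" and null: "emeasure (interval_measure F) {a..b} = 0" and "0 < e"
  shows "\<forall>\<^sub>F v in at_left a. F b - F v < e"
proof -
  define X where "X n = a - 1 / Suc n" for n
  have Ioc: "emeasure (interval_measure F) {X n<..b} = ennreal (F b - F (X n))" for n
    using \<open>a \<le> b\<close> F by (intro emeasure_interval_measure_Ioc)
      (auto simp: mono_def X_def intro: order_trans[of _ a])
  have "(\<lambda>n. emeasure (interval_measure F) {X n<..b}) \<longlonglongrightarrow> emeasure (interval_measure F) (\<Inter>n. {X n<..b})"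
  proof (rule Lim_emeasure_decseq)
    have "X m \<le> X n" if "m \<le> n" for m n using that by (simp add: X_def frac_le)
    then show "decseq (\<lambda>n. {X n<..b})" by (fastforce simp: decseq_def intro: le_less_trans)
  qed (auto simp: Ioc)
  also have "(\<Inter>n. {X n<..b}) = {a..b}"
  proof (intro antisym subsetI)
    fix x assume x: "x \<in> (\<Inter>n. {X n<..b})"
    have "X \<longlonglongrightarrow> a - 0"
      unfolding X_def by (intro tendsto_diff tendsto_const LIMSEQ_Suc[OF lim_1_over_n])
    then have "a \<le> x"
      using x by (intro LIMSEQ_le_const2[of X a x]) (auto intro: less_imp_le)
    then show "x \<in> {a..b}" using x by auto
  next
    fix x assume "x \<in> {a..b}"
    then show "x \<in> (\<Inter>n. {X n<..b})" by (auto simp: X_def intro: less_le_trans[of _ a])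
  qed
  finally have "(\<lambda>n. ennreal (F b - F (X n))) \<longlonglongrightarrow> 0" using null by (simp add: Ioc)
  then have "\<forall>\<^sub>F n in sequentially. ennreal (F b - F (X n)) < ennreal e"
    using \<open>0 < e\<close> by (intro order_tendstoD(2)) auto
  then obtain n where "ennreal (F b - F (X n)) < ennreal e"
    by (auto dest!: eventually_happens)
  then have n: "F b - F (X n) < e"
    using \<open>0 < e\<close> by (metis ennreal_leI not_le)
  have "X n < a" by (simp add: X_def)
  moreover have "F b - F v < e" if "X n < v" for v
    using n monoD[OF F(1), of "X n" v] that by simp
  ultimately show ?thesis by (auto simp: eventually_at_left_field)
qed

section \<open>Comparison of solutions\<close>

text \<open>
  The Skorokhod problem seen from the constraining term alone: \<open>x \<le> inv (g t) 0\<close> and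
  \<open>x \<ge> inv (h t) 0\<close> become \<open>k \<le> \<phi>\<close> and \<open>k \<ge> \<psi>\<close>. The functions \<open>U\<close> and \<open>D\<close> are
  the distribution functions extended by 0 to negative times, so that jumps at time 0 need no separate treatment.
\<close>

definition complementary_decomposition ::
  "(real \<Rightarrow> real) \<Rightarrow> (real \<Rightarrow> real) \<Rightarrow> (real \<Rightarrow> real) \<Rightarrow> (real \<Rightarrow> real) \<Rightarrow> (real \<Rightarrow> real) \<Rightarrow> bool" where
  "complementary_decomposition \<psi> \<phi> k U D \<longleftrightarrow>
     mono U \<and> mono D \<and> (\<forall>u. continuous (at_right u) U) \<and> (\<forall>u. continuous (at_right u) D) \<and>
     (\<forall>t<0. U t = 0 \<and> D t = 0) \<and>
     (\<forall>t\<ge>0. k t = U t - D t \<and> \<psi> t \<le> k t \<and> k t \<le> \<phi> t) \<and>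
     (\<forall>A\<in>sets borel. A \<subseteq> {0..} \<longrightarrow> (\<forall>u\<in>A. \<psi> u < k u) \<longrightarrow> emeasure (interval_measure U) A = 0) \<and>
     (\<forall>A\<in>sets borel. A \<subseteq> {0..} \<longrightarrow> (\<forall>u\<in>A. k u < \<phi> u) \<longrightarrow> emeasure (interval_measure D) A = 0)"

text \<open>
  The comparison behind uniqueness. Suppose that \<open>k > k'\<close> at time \<open>t\<close> and let \<open>\<tau>\<close> be the supremum
  of the times before \<open>t\<close> with \<open>k \<le> k'\<close>. Afterwards \<open>k > k' \<ge> \<psi>\<close>, so \<open>k\<close> is not pushed up, and
  \<open>k' < k \<le> \<phi>\<close>, so \<open>k'\<close> is not pushed down; hence \<open>k - k'\<close> cannot increase after \<open>\<tau>\<close> and is still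
  nonpositive at \<open>t\<close>, a contradiction.
  If \<open>\<tau>\<close> itself still has \<open>k > k'\<close>, the same argument includes the atoms at \<open>\<tau>\<close> and
  starts from times just before \<open>\<tau>\<close>.
\<close>

lemma complementary_decomposition_le:
  assumes 1: "complementary_decomposition \<psi> \<phi> k U D"
    and 2: "complementary_decomposition \<psi> \<phi> k' U' D'" and "0 \<le> t"
  shows "k t \<le> k' t"
proof (rule ccontr)
  assume "\<not> k t \<le> k' t"
  define \<Delta> where "\<Delta> u = (U u - D u) - (U' u - D' u)" for u
  have k: "k u = U u - D u" "\<psi> u \<le> k u" "k u \<le> \<phi> u" if "0 \<le> u" for u
    using 1 that unfolding complementary_decomposition_def by blast+
  have k': "k' u = U' u - D' u" "\<psi> u \<le> k' u" "k' u \<le> \<phi> u" if "0 \<le> u" for u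
    using 2 that unfolding complementary_decomposition_def by blast+
  have pos_t: "0 < \<Delta> t"
    using \<open>\<not> k t \<le> k' t\<close> \<open>0 \<le> t\<close> k k' by (simp add: \<Delta>_def)
  define S where "S = {u. u \<le> t \<and> \<Delta> u \<le> 0}"
  define \<tau> where "\<tau> = Sup S"
  \<comment> \<open>negative times belong to \<open>S\<close>, as both differences vanish there; hence \<open>S\<close> is nonempty even if \<open>k > k'\<close> on all of \<open>[0,t]\<close>\<close>
  have neg: "u \<in> S" if "u < 0" for u
    using that \<open>0 \<le> t\<close> 1 2 unfolding S_def complementary_decomposition_def \<Delta>_def by auto
  have S: "S \<noteq> {}" "bdd_above S" using neg[of "-1"] by (auto simp: S_def)
  have "\<tau> \<le> t" unfolding \<tau>_def using S by (intro cSup_least) (auto simp: S_def)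
  have le_\<tau>: "u \<le> \<tau>" if "u \<in> S" for u unfolding \<tau>_def using that S by (intro cSup_upper)
  have diff: "\<Delta> t \<le> \<Delta> v + (U t - U v) + (D' t - D' v)" if "v \<le> t" for v
  proof -
    have "D v \<le> D t" "U' v \<le> U' t" using 1 2 that unfolding complementary_decomposition_def mono_def by auto
    then show ?thesis by (simp add: \<Delta>_def)
  qed
  have off_lower: "emeasure (interval_measure U) A = 0"
    if "A \<in> sets borel" "A \<subseteq> {0..}" "\<forall>u\<in>A. \<psi> u < k u" for A
    using 1 that unfolding complementary_decomposition_def by blast
  have off_upper: "emeasure (interval_measure D') A = 0"
    if "A \<in> sets borel" "A \<subseteq> {0..}" "\<forall>u\<in>A. k' u < \<phi> u" for A
    using 2 that unfolding complementary_decomposition_def by blast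
  have null: "emeasure (interval_measure U) A = 0" "emeasure (interval_measure D') A = 0"
    if A: "A \<in> sets borel" and pos: "\<And>u. u \<in> A \<Longrightarrow> u \<notin> S" and le: "\<And>u. u \<in> A \<Longrightarrow> u \<le> t" for A
  proof -
    have "A \<subseteq> {0..}" using pos neg by (meson atLeast_iff not_less subsetI)
    moreover have "\<psi> u < k u \<and> k' u < \<phi> u" if "u \<in> A" for u
    proof -
      have "0 \<le> u" using \<open>A \<subseteq> {0..}\<close> that by auto
      moreover have "0 < \<Delta> u" using pos[OF that] le[OF that] by (auto simp: S_def)
      ultimately have "k' u < k u" using k k' by (simp add: \<Delta>_def)
      then show ?thesis using k(3)[OF \<open>0 \<le> u\<close>] k'(2)[OF \<open>0 \<le> u\<close>] by simp
    qed
    ultimately show "emeasure (interval_measure U) A = 0" "emeasure (interval_measure D') A = 0"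
      using A by (auto intro!: off_lower off_upper)
  qed
  have U: "mono U" "\<And>u. continuous (at_right u) U" and D': "mono D'" "\<And>u. continuous (at_right u) D'"
    using 1 2 by (auto simp: complementary_decomposition_def)
  show False
  proof (cases "\<tau> \<in> S")
    case True
    have "U t = U \<tau>" "D' t = D' \<tau>"
      using le_\<tau> by (intro interval_measure_null_Ioc U D' \<open>\<tau> \<le> t\<close> null; force)+
    then show False using diff[OF \<open>\<tau> \<le> t\<close>] True pos_t by (simp add: S_def)
  next
    case False
    define e where "e = \<Delta> t / 2"
    have "u \<notin> S" if "u \<in> {\<tau>..t}" for u
      using that le_\<tau>[of u] False by (cases "u = \<tau>") auto
    then have "\<forall>\<^sub>F v in at_left \<tau>. U t - U v < e" "\<forall>\<^sub>F v in at_left \<tau>. D' t - D' v < e"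
      using pos_t by (intro interval_measure_null_Icc U D' \<open>\<tau> \<le> t\<close> null; force simp: e_def)+
    then have "\<forall>\<^sub>F v in at_left \<tau>. U t - U v < e \<and> D' t - D' v < e" by (rule eventually_conj)
    then obtain a where a: "a < \<tau>" "\<And>v. a < v \<Longrightarrow> v < \<tau> \<Longrightarrow> U t - U v < e \<and> D' t - D' v < e"
      by (auto simp: eventually_at_left_field)
    obtain v where v: "v \<in> S" "a < v"
      using less_cSupD[OF S(1)] a(1) unfolding \<tau>_def by blast
    have "v < \<tau>" using le_\<tau>[OF v(1)] v(1) False by (cases "v = \<tau>") auto
    then show False
      using a(2)[of v] v diff[of v] by (auto simp: S_def e_def)
  qed
qed

section \<open>Monotone functions and cadlag functions\<close>

lemma right_continuous_zero_ext:
  assumes "f \<in> Dspace" shows "continuous (at_right u) (zero_ext f)"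
proof (cases "u < 0")
  case True
  then have ev: "\<forall>\<^sub>F v in at_right u. zero_ext f v = 0"
    by (auto simp: eventually_at_right_field zero_ext_def)
  show ?thesis
    unfolding continuous_within tendsto_cong[OF ev] using True by (simp add: zero_ext_def)
next
  case False
  then have ev: "\<forall>\<^sub>F v in at_right u. zero_ext f v = f v"
    by (auto simp: eventually_at_right_field zero_ext_def intro!: exI[of _ "u+1"])
  show ?thesis
    unfolding continuous_within tendsto_cong[OF ev]
    using False assms by (auto simp: zero_ext_def Dspace_def continuous_within)
qed

lemma mono_in_Dspace:
  fixes F :: "real \<Rightarrow> real"
  assumes "mono F" "\<And>u. continuous (at_right u) F" shows "F \<in> Dspace"
proof -
  have "(F \<longlongrightarrow> (SUP v\<in>{..<t}. F v)) (at_left t)" for t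
  proof (rule order_tendstoI)
    have bdd: "bdd_above (F ` {..<t})"
      using assms(1) by (intro bdd_aboveI2[where M="F t"]) (auto simp: mono_def)
    {
      fix y assume "y < (SUP v\<in>{..<t}. F v)"
      then obtain a where a: "a < t" "y < F a" using less_cSUP_iff[OF _ bdd] by force
      then have "y < F v" if "a < v" for v using monoD[OF assms(1), of a v] that by simp
      then show "\<forall>\<^sub>F v in at_left t. y < F v" using a by (auto simp: eventually_at_left_field)
    next
      fix y assume y: "(SUP v\<in>{..<t}. F v) < y"
      have "F v < y" if "v < t" for v
        using cSUP_upper[OF _ bdd, of v] that y by simp
      then show "\<forall>\<^sub>F v in at_left t. F v < y"
        by (auto simp: eventually_at_left_field intro!: exI[of _ "t - 1"])
    }
  qed
  then show ?thesis using assms(2) by (auto simp: Dspace_def)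
qed

lemma Dspace_add_diff:
  assumes "f \<in> Dspace" "g \<in> Dspace"
  shows "(\<lambda>t. f t + g t) \<in> Dspace" "(\<lambda>t. f t - g t) \<in> Dspace"
proof -
  have "\<exists>l. ((\<lambda>t. f t + g t) \<longlongrightarrow> l) (at_left t)"
    and "\<exists>l. ((\<lambda>t. f t - g t) \<longlongrightarrow> l) (at_left t)" if "0 < t" for t
  proof -
    obtain l l' where l: "(f \<longlongrightarrow> l) (at_left t)" "(g \<longlongrightarrow> l') (at_left t)"
      using assms \<open>0 < t\<close> unfolding Dspace_def by blast
    show "\<exists>l. ((\<lambda>t. f t + g t) \<longlongrightarrow> l) (at_left t)" "\<exists>l. ((\<lambda>t. f t - g t) \<longlongrightarrow> l) (at_left t)"
      using tendsto_add[OF l] tendsto_diff[OF l] by blast+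
  qed
  moreover have "continuous (at_right t) (\<lambda>t. f t + g t)" "continuous (at_right t) (\<lambda>t. f t - g t)"
    if "0 \<le> t" for t
    using assms that by (auto simp: Dspace_def intro: continuous_add continuous_diff)
  ultimately show "(\<lambda>t. f t + g t) \<in> Dspace" "(\<lambda>t. f t - g t) \<in> Dspace"
    by (simp_all add: Dspace_def)
qed

lemma mono_diff_in_BVspace:
  assumes "(\<lambda>t. F t - G t) \<in> Dspace" and "mono F" "mono G"
  shows "(\<lambda>t. F t - G t) \<in> BVspace"
proof -
  have "bounded_variation_between (\<lambda>t. F t - G t) 0 T" for T
    unfolding bounded_variation_between_def
  proof (intro exI allI impI)
    fix n :: nat and p :: "nat \<Rightarrow> real"
    assume p: "mono_on {..n} p \<and> p ` {..n} \<subseteq> {0..T}"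
    have "(\<Sum>i<n. \<bar>(F (p (Suc i)) - G (p (Suc i))) - (F (p i) - G (p i))\<bar>)
        \<le> (\<Sum>i<n. (F (p (Suc i)) + G (p (Suc i))) - (F (p i) + G (p i)))"
    proof (rule sum_mono)
      fix i assume "i \<in> {..<n}"
      then have "p i \<le> p (Suc i)" using p by (auto intro: mono_onD)
      then have "F (p i) \<le> F (p (Suc i))" "G (p i) \<le> G (p (Suc i))"
        using assms(2,3) by (auto simp: mono_def)
      then show "\<bar>(F (p (Suc i)) - G (p (Suc i))) - (F (p i) - G (p i))\<bar>
        \<le> (F (p (Suc i)) + G (p (Suc i))) - (F (p i) + G (p i))" by linarith
    qed
    also have "\<dots> = (F (p n) + G (p n)) - (F (p 0) + G (p 0))"
      by (rule sum_lessThan_telescope)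
    also have "\<dots> \<le> (F T + G T) - (F 0 + G 0)"
      using p assms(2,3) by (intro diff_mono add_mono monoD[of F] monoD[of G]) auto
    finally show "(\<Sum>i<n. \<bar>(F (p (Suc i)) - G (p (Suc i))) - (F (p i) - G (p i))\<bar>)
      \<le> (F T + G T) - (F 0 + G 0)" .
  qed
  then show ?thesis using assms(1) by (auto simp: BVspace_def)
qed

section \<open>Global pushes\<close>

lemma reflecting_split_sum:
  assumes "\<And>n::nat. reflecting_split \<psi> \<phi> k n (Suc n) (P n) (N n)"
  shows "reflecting_split \<psi> \<phi> k 0 (real M) (\<lambda>t. \<Sum>n<M. P n t) (\<lambda>t. \<Sum>n<M. N n t)"
proof (induction M)
  case 0
  then show ?case using reflecting_split_refl[of \<psi> \<phi> k 0] by simp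
next
  case (Suc M)
  then show ?case using reflecting_split_join[OF Suc assms[of M]] by simp
qed

text \<open>
  This carries the initial jump of a push at time 0, which is invisible in the increments over
  intervals \<open>[n,n+1]\<close>.
\<close>

lemma zero_ext_const:
  assumes "0 \<le> c"
  shows "mono (zero_ext (\<lambda>_. c))" "continuous (at_right u) (zero_ext (\<lambda>_. c))"
    "u \<noteq> 0 \<or> c = 0 \<Longrightarrow> flat_at (zero_ext (\<lambda>_. c)) u"
proof -
  show "mono (zero_ext (\<lambda>_. c))" using assms by (auto simp: mono_def zero_ext_def)
  show "continuous (at_right u) (zero_ext (\<lambda>_. c))"
    by (rule right_continuous_zero_ext) (auto simp: Dspace_def)
  assume "u \<noteq> 0 \<or> c = 0"
  then consider "c = 0" | "u < 0" | "0 < u" by linarith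
  then show "flat_at (zero_ext (\<lambda>_. c)) u"
  proof cases
    case 1
    then show ?thesis by (intro flat_at_if_locally_const[where c=0]) (auto simp: zero_ext_def)
  next
    case 2
    have "\<forall>\<^sub>F v in nhds u. zero_ext (\<lambda>_. c) v = 0"
      by (rule eventually_mono[OF eventually_nhds_in_open[of "{..<0}"]])
        (use 2 in \<open>auto simp: zero_ext_def\<close>)
    then show ?thesis by (rule flat_at_if_locally_const)
  next
    case 3
    have "\<forall>\<^sub>F v in nhds u. zero_ext (\<lambda>_. c) v = c"
      by (rule eventually_mono[OF eventually_nhds_in_open[of "{0<..}"]])
        (use 3 in \<open>auto simp: zero_ext_def\<close>)
    then show ?thesis by (rule flat_at_if_locally_const)
  qed
qed

text \<open>
  The sums of the pushes over \<open>[n,n+1]\<close>, plus the initial jump from 0 to \<open>k 0\<close>, are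
  global pushes. Before each time only finitely many summands are nonzero, so all properties reduce to finite
  sums. The hypotheses on \<open>k 0\<close> say that the initial jump is complementary as well.
\<close>

lemma glue_reflecting_splits:
  assumes split: "\<And>n::nat. reflecting_split \<psi> \<phi> k n (Suc n) (P n) (N n)"
    and up: "\<psi> 0 < k 0 \<Longrightarrow> k 0 \<le> 0" and down: "k 0 < \<phi> 0 \<Longrightarrow> 0 \<le> k 0"
  obtains U D where "mono U" "mono D" "\<And>u. continuous (at_right u) U" "\<And>u. continuous (at_right u) D"
    "\<And>t. t < 0 \<Longrightarrow> U t = 0 \<and> D t = 0" "\<And>t. 0 \<le> t \<Longrightarrow> k t = U t - D t"
    "\<And>u. 0 \<le> u \<Longrightarrow> \<psi> u < k u \<Longrightarrow> flat_at U u" "\<And>u. 0 \<le> u \<Longrightarrow> k u < \<phi> u \<Longrightarrow> flat_at D u"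
proof -
  define U where "U t = zero_ext (\<lambda>_. max (k 0) 0) t + (\<Sum>n<nat \<lceil>t\<rceil>. P n t)" for t
  define D where "D t = zero_ext (\<lambda>_. max (- k 0) 0) t + (\<Sum>n<nat \<lceil>t\<rceil>. N n t)" for t
  define UM where "UM M t = zero_ext (\<lambda>_. max (k 0) 0) t + (\<Sum>n<M. P n t)" for M t
  define DM where "DM M t = zero_ext (\<lambda>_. max (- k 0) 0) t + (\<Sum>n<M. N n t)" for M t
  have eq: "U t = UM M t \<and> D t = DM M t" if "t \<le> real M" for t M
  proof -
    \<comment> \<open>the pushes over \<open>[n,n+1]\<close> vanish up to time \<open>n\<close>\<close>
    have "P n t = 0 \<and> N n t = 0" if "n \<in> {..<M} - {..<nat \<lceil>t\<rceil>}" for n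
      using split[of n] that by (auto simp: reflecting_split_def not_less nat_le_iff ceiling_le_iff)
    moreover have "nat \<lceil>t\<rceil> \<le> M" using that by (simp add: ceiling_le_iff nat_le_iff)
    then have "{..<nat \<lceil>t\<rceil>} \<subseteq> {..<M}" by auto
    ultimately have "(\<Sum>n<nat \<lceil>t\<rceil>. P n t) = (\<Sum>n<M. P n t)" "(\<Sum>n<nat \<lceil>t\<rceil>. N n t) = (\<Sum>n<M. N n t)"
      by (intro sum.mono_neutral_left; blast)+
    then show ?thesis unfolding U_def D_def UM_def DM_def by simp
  qed
  have ex: "\<exists>M::nat. t < real M" for t using reals_Archimedean2 by blast
  have near: "(\<forall>\<^sub>F v in nhds u. U v = UM M v) \<and> (\<forall>\<^sub>F v in nhds u. D v = DM M v)" if "u < real M" for u M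
    using eventually_nhds_in_open[of "{..<real M}" u] that eq[of _ M] by (auto elim!: eventually_mono)
  have M: "mono (UM M)" "mono (DM M)" "continuous (at_right u) (UM M)" "continuous (at_right u) (DM M)"
    "0 \<le> t \<Longrightarrow> t \<le> real M \<Longrightarrow> k t = UM M t - DM M t"
    "t < 0 \<Longrightarrow> UM M t = 0 \<and> DM M t = 0"
    "0 \<le> u \<Longrightarrow> \<psi> u < k u \<Longrightarrow> flat_at (UM M) u" "0 \<le> u \<Longrightarrow> k u < \<phi> u \<Longrightarrow> flat_at (DM M) u" for M u t
  proof -
    note * = reflecting_split_sum[of \<psi> \<phi> k P N M, OF split]
    have sums: "mono (\<lambda>t. \<Sum>n<M. P n t)" "mono (\<lambda>t. \<Sum>n<M. N n t)"
      "continuous (at_right u) (\<lambda>t. \<Sum>n<M. P n t)" "continuous (at_right u) (\<lambda>t. \<Sum>n<M. N n t)"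
      using * unfolding reflecting_split_def by blast+
    show "mono (UM M)" unfolding UM_def[abs_def]
      by (intro monoI add_mono monoD[OF zero_ext_const(1)] monoD[OF sums(1)]) auto
    show "mono (DM M)" unfolding DM_def[abs_def]
      by (intro monoI add_mono monoD[OF zero_ext_const(1)] monoD[OF sums(2)]) auto
    show "continuous (at_right u) (UM M)" unfolding UM_def[abs_def]
      by (intro continuous_add sums(3) zero_ext_const(2)) auto
    show "continuous (at_right u) (DM M)" unfolding DM_def[abs_def]
      by (intro continuous_add sums(4) zero_ext_const(2)) auto
    show "k t = UM M t - DM M t" if "0 \<le> t" "t \<le> real M"
    proof -
      have "k t - k 0 = (\<Sum>n<M. P n t) - (\<Sum>n<M. N n t)"
        using * that unfolding reflecting_split_def by auto
      then show ?thesis using that by (auto simp: UM_def DM_def zero_ext_def max_def)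
    qed
    show "UM M t = 0 \<and> DM M t = 0" if "t < 0"
      using * that unfolding reflecting_split_def by (auto simp: UM_def DM_def zero_ext_def)
    show "flat_at (UM M) u" if "0 \<le> u" "\<psi> u < k u"
      unfolding UM_def[abs_def] using up that
      by (intro flat_at_add zero_ext_const(3) reflecting_split_flat(1)[OF *]) auto
    show "flat_at (DM M) u" if "0 \<le> u" "k u < \<phi> u"
      unfolding DM_def[abs_def] using down that
      by (intro flat_at_add zero_ext_const(3) reflecting_split_flat(2)[OF *]) auto
  qed
  have at_right: "\<forall>\<^sub>F v in at_right u. F v = G v" if "\<forall>\<^sub>F v in nhds u. F v = G v" for F G :: "real \<Rightarrow> real" and u
    using that by (auto simp: eventually_at_filter elim: eventually_mono)
  show thesis
  proof (rule that[of U D])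
    show "mono U" "mono D"
    proof -
      have "U s \<le> U t \<and> D s \<le> D t" if "s \<le> t" for s t
      proof -
        obtain M :: nat where "t < real M" using ex by blast
        then show ?thesis
          using eq[of s M] eq[of t M] monoD[OF M(1)[of M] that] monoD[OF M(2)[of M] that] that by simp
      qed
      then show "mono U" "mono D" by (auto simp: mono_def)
    qed
    fix u :: real
    obtain m where m: "u < real m" using ex by blast
    show "continuous (at_right u) U"
      using continuous_at_right_if_eventually_eq[OF at_right[OF conjunct1[OF near[OF m]]]] M(3) eq m by auto
    show "continuous (at_right u) D"
      using continuous_at_right_if_eventually_eq[OF at_right[OF conjunct2[OF near[OF m]]]] M(4) eq m by auto
    show "U u = 0 \<and> D u = 0" if "u < 0" using M(6)[OF that, of m] eq[of u m] m by simp
    show "k u = U u - D u" if "0 \<le> u" using M(5)[OF that, of m] eq[of u m] m by simp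
    show "flat_at U u" if "0 \<le> u" "\<psi> u < k u"
      using near[OF m] M(7)[OF that, of m] by (blast intro: flat_at_cong)
    show "flat_at D u" if "0 \<le> u" "k u < \<phi> u"
      using near[OF m] M(8)[OF that, of m] by (blast intro: flat_at_cong)
  qed
qed

section \<open>The Skorokhod problem\<close>

lemma strict_mono_zero_iff:
  fixes f :: "real \<Rightarrow> real"
  assumes "strict_mono f" "0 \<in> range f"
  shows "f y < 0 \<longleftrightarrow> y < inv f 0" "f y \<le> 0 \<longleftrightarrow> y \<le> inv f 0"
    "0 < f y \<longleftrightarrow> inv f 0 < y" "0 \<le> f y \<longleftrightarrow> inv f 0 \<le> y"
  using strict_mono_less[OF assms(1), of y "inv f 0"] strict_mono_less_eq[OF assms(1), of y "inv f 0"]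
    strict_mono_less[OF assms(1), of "inv f 0" y] strict_mono_less_eq[OF assms(1), of "inv f 0" y]
    f_inv_into_f[OF assms(2)] by simp_all

text \<open>
  The inequality \<open>g < h\<close> orders the zeros, so the infimum in the definition of admissibility is taken
  over a set that is bounded below and is a genuine lower bound.
\<close>

lemma admissible_pair_gap:
  assumes "admissible_pair g h"
  obtains \<delta> where "0 < \<delta>" "\<And>t. 0 \<le> t \<Longrightarrow> inv (h t) 0 + \<delta> \<le> inv (g t) 0"
proof -
  let ?\<delta> = "INF t\<in>{0..}. inv (g t) 0 - inv (h t) 0"
  have "inv (h t) 0 \<le> inv (g t) 0" if "0 \<le> t" for t
  proof -
    have zero: "g t (inv (g t) 0) = 0" "h t (inv (h t) 0) = 0"
      and "strict_mono (h t)" "g t (inv (g t) 0) < h t (inv (g t) 0)"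
      using assms that by (auto simp: admissible_pair_def intro: f_inv_into_f)
    then have "h t (inv (h t) 0) < h t (inv (g t) 0)" by simp
    then show ?thesis using strict_mono_less[OF \<open>strict_mono (h t)\<close>] by simp
  qed
  then have "bdd_below ((\<lambda>t. inv (g t) 0 - inv (h t) 0) ` {0..})"
    by (intro bdd_belowI2[where m=0]) simp
  then have "?\<delta> \<le> inv (g t) 0 - inv (h t) 0" if "0 \<le> t" for t
    using that by (intro cINF_lower) auto
  then show thesis
    using assms by (intro that[of ?\<delta>]) (force simp: admissible_pair_def algebra_simps)+
qed

text \<open>
  Turns a complementarity integral into the nullity of the measurable sets on which the constraint is
  strict, the form in which it enters the comparison of solutions.
\<close>

lemma emeasure_eq_0_if_nn_integral:
  assumes "(\<integral>\<^sup>+u\<in>{0..}. indicator B u \<partial>M) = 0" "A \<in> sets M" "A \<subseteq> {0..}" "A \<subseteq> B"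
  shows "emeasure M A = 0"
proof -
  have "emeasure M A = (\<integral>\<^sup>+u. indicator A u \<partial>M)" using assms(2) by simp
  also have "\<dots> \<le> (\<integral>\<^sup>+u\<in>{0..}. indicator B u \<partial>M)"
    using assms(3,4) by (intro nn_integral_mono) (auto split: split_indicator)
  finally show ?thesis using assms(1) by simp
qed

lemma solves_SP_decomposition:
  assumes adm: "admissible_pair g h" and sol: "solves_SP g h s x k"
  shows "\<exists>U D. complementary_decomposition (\<lambda>t. inv (h t) 0 - s t) (\<lambda>t. inv (g t) 0 - s t) k U D"
proof -
  from sol obtain kh kg where kh: "increasing_process kh" and kg: "increasing_process kg"
    and k: "\<And>t. 0 \<le> t \<Longrightarrow> k t = kh t - kg t"
    and null_g: "(\<integral>\<^sup>+u\<in>{0..}. indicator {u. g u (x u) < 0} u \<partial>stieltjes kg) = 0"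
    and null_h: "(\<integral>\<^sup>+u\<in>{0..}. indicator {u. h u (x u) > 0} u \<partial>stieltjes kh) = 0"
    and x: "\<And>t. 0 \<le> t \<Longrightarrow> x t = s t + k t"
    and gx: "\<And>t. 0 \<le> t \<Longrightarrow> g t (x t) \<le> 0" and hx: "\<And>t. 0 \<le> t \<Longrightarrow> 0 \<le> h t (x t)"
    unfolding solves_SP_def by blast
  have sm: "strict_mono (g t)" "0 \<in> range (g t)" "strict_mono (h t)" "0 \<in> range (h t)" if "0 \<le> t" for t
    using adm that by (auto simp: admissible_pair_def)
  have "complementary_decomposition (\<lambda>t. inv (h t) 0 - s t) (\<lambda>t. inv (g t) 0 - s t) k
    (zero_ext kh) (zero_ext kg)"
    unfolding complementary_decomposition_def
  proof (intro conjI allI impI ballI)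
    show "mono (zero_ext kh)" "mono (zero_ext kg)"
      using kh kg by (auto simp: increasing_process_def)
    show "continuous (at_right u) (zero_ext kh)" "continuous (at_right u) (zero_ext kg)" for u
      using kh kg by (auto simp: increasing_process_def intro: right_continuous_zero_ext)
    fix t :: real
    show "zero_ext kh t = 0" "zero_ext kg t = 0" if "t < 0" using that by (auto simp: zero_ext_def)
    show "k t = zero_ext kh t - zero_ext kg t" if "0 \<le> t" using that k by (simp add: zero_ext_def)
    show "inv (h t) 0 - s t \<le> k t" if "0 \<le> t"
      using hx[OF that] x[OF that] strict_mono_zero_iff(4)[OF sm(3,4)[OF that]] by simp
    show "k t \<le> inv (g t) 0 - s t" if "0 \<le> t"
      using gx[OF that] x[OF that] strict_mono_zero_iff(2)[OF sm(1,2)[OF that]] by simp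
  next
    fix A :: "real set" assume A: "A \<in> sets borel" "A \<subseteq> {0..}" "\<forall>u\<in>A. inv (h u) 0 - s u < k u"
    have "0 < h u (x u)" if "u \<in> A" for u
    proof -
      have "0 \<le> u" using A(2) that by auto
      then show ?thesis
        using A(3) that x[of u] by (subst strict_mono_zero_iff(3)[OF sm(3,4)[OF \<open>0 \<le> u\<close>]]) auto
    qed
    then have "A \<subseteq> {u. h u (x u) > 0}" by blast
    then show "emeasure (stieltjes kh) A = 0"
      using A by (intro emeasure_eq_0_if_nn_integral[OF null_h]) auto
  next
    fix A :: "real set" assume A: "A \<in> sets borel" "A \<subseteq> {0..}" "\<forall>u\<in>A. k u < inv (g u) 0 - s u"
    have "g u (x u) < 0" if "u \<in> A" for u
    proof -
      have "0 \<le> u" using A(2) that by auto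
      then show ?thesis
        using A(3) that x[of u] by (subst strict_mono_zero_iff(1)[OF sm(1,2)[OF \<open>0 \<le> u\<close>]]) auto
    qed
    then have "A \<subseteq> {u. g u (x u) < 0}" by blast
    then show "emeasure (stieltjes kg) A = 0"
      using A by (intro emeasure_eq_0_if_nn_integral[OF null_g]) auto
  qed
  then show ?thesis by blast
qed

lemma solves_SPI:
  assumes "x \<in> Dspace" "k \<in> BVspace" "\<And>t. 0 \<le> t \<Longrightarrow> x t = s t + k t"
    and "\<And>t. 0 \<le> t \<Longrightarrow> g t (x t) \<le> 0" "\<And>t. 0 \<le> t \<Longrightarrow> 0 \<le> h t (x t)"
    and "increasing_process kh" "increasing_process kg" "\<And>t. 0 \<le> t \<Longrightarrow> k t = kh t - kg t"
    and "(\<integral>\<^sup>+u\<in>{0..}. indicator {u. g u (x u) < 0} u \<partial>stieltjes kg) = 0"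
    and "(\<integral>\<^sup>+u\<in>{0..}. indicator {u. h u (x u) > 0} u \<partial>stieltjes kh) = 0"
  shows "solves_SP g h s x k"
proof -
  have ex: "\<exists>kh kg. increasing_process kh \<and> increasing_process kg \<and> (\<forall>t\<ge>0. k t = kh t - kg t) \<and>
    (\<integral>\<^sup>+u\<in>{0..}. indicator {u. g u (x u) < 0} u \<partial>stieltjes kg) = 0 \<and>
    (\<integral>\<^sup>+u\<in>{0..}. indicator {u. h u (x u) > 0} u \<partial>stieltjes kh) = 0"
    by (rule exI[of _ kh], rule exI[of _ kg]) (intro conjI allI impI assms)
  show ?thesis unfolding solves_SP_def by (intro conjI allI impI assms ex)
qed

text \<open>
  Existence: the pushes from the global split of the double reflection are the two parts of
  the constraining term, and each is flat wherever the corresponding constraint is strict.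
\<close>

lemma solves_SP_double_reflection:
  assumes adm: "admissible_pair g h" and s: "s \<in> Dspace"
  defines "\<phi> \<equiv> \<lambda>t. inv (g t) 0 - s t" and "\<psi> \<equiv> \<lambda>t. inv (h t) 0 - s t"
  shows "\<exists>x k. solves_SP g h s x k \<and>
    (\<forall>t\<ge>0. k t = double_reflection \<psi> \<phi> (- neg_part (\<phi> 0)) 0 t)"
proof -
  define \<kappa> where "\<kappa> = double_reflection \<psi> \<phi> (- neg_part (\<phi> 0)) 0"
  have D: "\<psi> \<in> Dspace" "\<phi> \<in> Dspace"
    using adm s unfolding \<phi>_def \<psi>_def by (auto simp: admissible_pair_def intro: Dspace_add_diff)
  obtain \<delta> where \<delta>: "0 < \<delta>" "\<And>t. 0 \<le> t \<Longrightarrow> \<psi> t + \<delta> \<le> \<phi> t"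
    using admissible_pair_gap[OF adm] unfolding \<phi>_def \<psi>_def by (auto simp: algebra_simps)
  have sm: "strict_mono (g t)" "0 \<in> range (g t)" "strict_mono (h t)" "0 \<in> range (h t)" if "0 \<le> t" for t
    using adm that by (auto simp: admissible_pair_def)
  have bounds: "\<psi> t \<le> \<kappa> t" "\<kappa> t \<le> \<phi> t" if "0 \<le> t" for t
    using double_reflection_bounds[OF bdd_above_Dspace[OF D(1), of 0 t] that, of \<phi>] \<delta>(1) \<delta>(2)[OF that]
    unfolding \<kappa>_def by auto
  have \<kappa>_0: "\<kappa> 0 = min (max (min (\<phi> 0) 0) (\<psi> 0)) (max (\<phi> 0) (\<psi> 0))"
    by (simp add: \<kappa>_def double_reflection_def neg_part_def min_def max_def)
  have "\<exists>P N. reflecting_split \<psi> \<phi> \<kappa> (real n) (real (Suc n)) P N" for n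
    by (rule double_reflection_split[OF D \<delta>]) (auto simp: \<kappa>_def)
  then obtain P N where split: "\<And>n. reflecting_split \<psi> \<phi> \<kappa> (real n) (real (Suc n)) (P n) (N n)"
    by metis
  obtain kh kg where kh: "mono kh" "\<And>u. continuous (at_right u) kh"
      "\<And>u. 0 \<le> u \<Longrightarrow> \<psi> u < \<kappa> u \<Longrightarrow> flat_at kh u"
    and kg: "mono kg" "\<And>u. continuous (at_right u) kg"
      "\<And>u. 0 \<le> u \<Longrightarrow> \<kappa> u < \<phi> u \<Longrightarrow> flat_at kg u"
    and neg: "\<And>t. t < 0 \<Longrightarrow> kh t = 0 \<and> kg t = 0" and \<kappa>: "\<And>t. 0 \<le> t \<Longrightarrow> \<kappa> t = kh t - kg t"
  proof (rule glue_reflecting_splits[OF split])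
    show "\<psi> 0 < \<kappa> 0 \<Longrightarrow> \<kappa> 0 \<le> 0" "\<kappa> 0 < \<phi> 0 \<Longrightarrow> 0 \<le> \<kappa> 0"
      unfolding \<kappa>_0 by (auto simp: min_def max_def split: if_splits)
  qed blast
  have ext: "zero_ext kh = kh" "zero_ext kg = kg" using neg by (auto simp: zero_ext_def)
  have incr: "increasing_process kh" "increasing_process kg"
    using kh kg mono_in_Dspace by (auto simp: increasing_process_def ext)
  \<comment> \<open>equal to \<open>\<kappa>\<close> on \<open>[0,\<infinity>)\<close>, but a difference of monotone functions on the whole line\<close>
  define k where "k t = kh t - kg t" for t
  define x where "x t = s t + k t" for t
  have k: "k t = \<kappa> t" if "0 \<le> t" for t using \<kappa>[OF that] by (simp add: k_def)
  have kBV: "k \<in> BVspace"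
    unfolding k_def[abs_def]
    using kh kg incr by (intro mono_diff_in_BVspace Dspace_add_diff) (auto simp: increasing_process_def)
  have "solves_SP g h s x k"
  proof (rule solves_SPI[where kh=kh and kg=kg])
    show "x \<in> Dspace" unfolding x_def[abs_def] using s kBV by (auto intro: Dspace_add_diff simp: BVspace_def)
    show "k t = kh t - kg t" for t by (simp add: k_def)
    show "(\<integral>\<^sup>+u\<in>{0..}. indicator {u. g u (x u) < 0} u \<partial>stieltjes kg) = 0" unfolding ext
    proof (rule nn_integral_flat_eq_0)
      fix u assume "0 \<le> u" "u \<in> {u. g u (x u) < 0}"
      then have "x u < inv (g u) 0" using strict_mono_zero_iff(1)[OF sm(1,2)] by simp
      then show "flat_at kg u" using \<open>0 \<le> u\<close> k by (intro kg) (auto simp: x_def \<phi>_def)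
    qed (fact kg)+
    show "(\<integral>\<^sup>+u\<in>{0..}. indicator {u. h u (x u) > 0} u \<partial>stieltjes kh) = 0" unfolding ext
    proof (rule nn_integral_flat_eq_0)
      fix u assume "0 \<le> u" "u \<in> {u. 0 < h u (x u)}"
      then have "inv (h u) 0 < x u" using strict_mono_zero_iff(3)[OF sm(3,4)] by simp
      then show "flat_at kh u" using \<open>0 \<le> u\<close> k by (intro kh) (auto simp: x_def \<psi>_def)
    qed (fact kh)+
    show "g t (x t) \<le> 0" if "0 \<le> t" for t
      using bounds(2)[OF that] k[OF that] strict_mono_zero_iff(2)[OF sm(1,2)[OF that]]
      by (simp add: x_def \<phi>_def)
    show "0 \<le> h t (x t)" if "0 \<le> t" for t
      using bounds(1)[OF that] k[OF that] strict_mono_zero_iff(4)[OF sm(3,4)[OF that]]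
      by (simp add: x_def \<psi>_def)
  qed (simp_all add: kBV incr x_def)
  then show ?thesis using k unfolding \<kappa>_def by blast
qed

theorem theorem2p18:
  fixes g h :: "real \<Rightarrow> real \<Rightarrow> real" and s :: "real \<Rightarrow> real"
  assumes "admissible_pair g h"
    and "s \<in> Dspace"
  defines "\<phi> \<equiv> \<lambda>t. inv (g t) 0 - s t"
    and "\<psi> \<equiv> \<lambda>t. inv (h t) 0 - s t"
  shows "\<exists>x k. solves_SP g h s x k \<and>
    (\<forall>x' k'. solves_SP g h s x' k' \<longrightarrow> (\<forall>t\<ge>0. x' t = x t \<and> k' t = k t)) \<and>
    (\<forall>t\<ge>0. k t =
       min (max (- neg_part (\<phi> 0)) (SUP r\<in>{0..t}. \<psi> r))
           (INF u\<in>{0..t}. max (\<phi> u) (SUP r\<in>{u..t}. \<psi> r)))"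
proof -
  obtain x k where sol: "solves_SP g h s x k"
    and k: "\<forall>t\<ge>0. k t = double_reflection \<psi> \<phi> (- neg_part (\<phi> 0)) 0 t"
    using solves_SP_double_reflection[OF assms(1,2)] unfolding \<phi>_def \<psi>_def by blast
  have "x' t = x t \<and> k' t = k t" if sol': "solves_SP g h s x' k'" and "0 \<le> t" for x' k' t
  proof -
    have "k' t = k t"
    proof -
      obtain U D U' D' where *: "complementary_decomposition \<psi> \<phi> k U D"
          "complementary_decomposition \<psi> \<phi> k' U' D'"
        using solves_SP_decomposition[OF assms(1) sol] solves_SP_decomposition[OF assms(1) sol']
        unfolding \<phi>_def \<psi>_def by blast
      show ?thesis
        using complementary_decomposition_le[OF *(1,2) \<open>0 \<le> t\<close>]
          complementary_decomposition_le[OF *(2,1) \<open>0 \<le> t\<close>] by (rule antisym[rotated])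
    qed
    then show ?thesis using sol sol' \<open>0 \<le> t\<close> by (simp add: solves_SP_def)
  qed
  then show ?thesis using sol k unfolding double_reflection_def by blast
qed

end
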